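(* Any commutative sequential effect space is isomorphic (as a sequential effect algebra) to the unit interval $\{f\in C(X): 0\leq f\leq 1\}$ of some $C(X)$, with pointwise multiplication as sequential product, where $X$ is a basically disconnected compact Hausdorff space. Conversely, for any basically disconnected compact Hausdorff space $X$, the unit interval of $C(X)$ with pointwise multiplication as sequential product is a commutative sequential effect space.
   Context: Effect algebra: a set $E$ with elements $0,1$ and a partially defined operation $+$ that is commutative and associative (where defined: if $x+y$ is defined so is $y+x$ and they are equal; if $y+z$ and $x+(y+z)$ are defined then so are $x+y$ and $(x+y)+z$, and $x+(y+z)=(x+y)+z$), with $x+0=x$ always defined, such that $x+1$ defined implies $x=0$, and such that each $x$ has a unique $x^\perp$ with $x+x^\perp=1$. It is partially ordered by $x\leq y\iff\exists z: x+z=y$. Sequential effect algebra (SEA): an effect algebra with a total binary operation $\circ$ (the sequential product) such that, writing $a\mid b$ for $a\circ b=b\circ a$: (1) $a\circ(b+c)=a\circ b+a\circ c$ whenever $b+c$ is defined; (2) $1\circ a=a$; (3) $a\circ b=0\Rightarrow b\circ a=0$; (4) if $a\mid b$ then $a\mid b^\perp$ and $a\circ(b\circ c)=(a\circ b)\circ c$ for all $c$; (5) if $c\mid a$ and $c\mid b$ then $c\mid(a\circ b)$ and, if $a+b$ is defined, $c\mid(a+b)$. It is commutative if $a\mid b$ for all $a,b$. $\sigma$-SEA: a SEA in which every descending sequence $a_1\geq a_2\geq\cdots$ has an infimum $\bigwedge a_i$, with $b\circ\bigwedge a_i=\bigwedge(b\circ a_i)$, and $b\mid a_i$ for all $i$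 implies $b\mid\bigwedge a_i$. Convex effect algebra: an effect algebra with an action $[0,1]\times E\to E$ such that for $r,s\in[0,1]$: if $r+s\leq 1$ then $ra+sa$ is defined and equals $(r+s)a$; $(rs)a=r(sa)$; $0a=0$, $1a=a$; if $a+b$ is defined then $ra+rb$ is defined and equals $r(a+b)$. A sequential effect space (SES) is a convex $\sigma$-SEA. For a compact Hausdorff space $X$, $C(X)$ is the space of continuous functions $X\to\mathbb R$ with the pointwise order. The sum of $f,g$ in the unit interval of $C(X)$ is defined iff $f+g\leq 1$. A zero-set is a set $f^{-1}(0)$ with $f\in C(X)$. $X$ is basically disconnected when the interior of every zero-set is closed. *)

theory Defs
  imports "HOL-Analysis.Analysis" "HOL-Algebra.Congruence"
begin

text \<open>The partial sum is encoded by its domain of definition \<open>orth\<close> together with a total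
  function \<open>esum\<close> whose values outside that domain carry no meaning.\<close>

record 'a eff_alg = "'a partial_object" +
  ezero :: 'a (\<open>\<zero>\<^sub>E\<index>\<close>)
  eone :: 'a (\<open>\<one>\<^sub>E\<index>\<close>)
  orth :: "'a \<Rightarrow> 'a \<Rightarrow> bool" (infix \<open>\<perp>\<index>\<close> 50)
  esum :: "'a \<Rightarrow> 'a \<Rightarrow> 'a" (infixl \<open>\<boxplus>\<index>\<close> 65)

record 'a seq_eff_alg = "'a eff_alg" +
  sprod :: "'a \<Rightarrow> 'a \<Rightarrow> 'a" (infixl \<open>\<odot>\<index>\<close> 70)

locale effect_algebra =
  fixes E :: "('a, 'm) eff_alg_scheme" (structure)
  assumes zero_closed: "\<zero>\<^sub>E \<in> carrier E"
    and one_closed: "\<one>\<^sub>E \<in> carrier E"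
    and esum_closed: "\<lbrakk>x \<in> carrier E; y \<in> carrier E; x \<perp> y\<rbrakk> \<Longrightarrow> x \<boxplus> y \<in> carrier E"
    and esum_comm: "\<lbrakk>x \<in> carrier E; y \<in> carrier E; x \<perp> y\<rbrakk> \<Longrightarrow> y \<perp> x \<and> x \<boxplus> y = y \<boxplus> x"
    and esum_assoc:
      "\<lbrakk>x \<in> carrier E; y \<in> carrier E; z \<in> carrier E; y \<perp> z; x \<perp> (y \<boxplus> z)\<rbrakk>
        \<Longrightarrow> x \<perp> y \<and> (x \<boxplus> y) \<perp> z \<and> x \<boxplus> (y \<boxplus> z) = (x \<boxplus> y) \<boxplus> z"
    and esum_zero: "x \<in> carrier E \<Longrightarrow> x \<perp> \<zero>\<^sub>E \<and> x \<boxplus> \<zero>\<^sub>E = x"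
    and orth_one: "\<lbrakk>x \<in> carrier E; x \<perp> \<one>\<^sub>E\<rbrakk> \<Longrightarrow> x = \<zero>\<^sub>E"
    and ex1_compl: "x \<in> carrier E \<Longrightarrow> \<exists>!y. y \<in> carrier E \<and> x \<perp> y \<and> x \<boxplus> y = \<one>\<^sub>E"

definition ecompl :: "('a, 'm) eff_alg_scheme \<Rightarrow> 'a \<Rightarrow> 'a"
  where "ecompl E x = (THE y. y \<in> carrier E \<and> x \<perp>\<^bsub>E\<^esub> y \<and> x \<boxplus>\<^bsub>E\<^esub> y = \<one>\<^sub>E\<^bsub>E\<^esub>)"

definition eff_le :: "('a, 'm) eff_alg_scheme \<Rightarrow> 'a \<Rightarrow> 'a \<Rightarrow> bool" (infix \<open>\<preceq>\<index>\<close> 50)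
  where "x \<preceq>\<^bsub>E\<^esub> y \<longleftrightarrow> (\<exists>z\<in>carrier E. x \<perp>\<^bsub>E\<^esub> z \<and> x \<boxplus>\<^bsub>E\<^esub> z = y)"

definition is_eff_inf :: "('a, 'm) eff_alg_scheme \<Rightarrow> 'a set \<Rightarrow> 'a \<Rightarrow> bool"
  where "is_eff_inf E S m \<longleftrightarrow> m \<in> carrier E \<and> (\<forall>x\<in>S. m \<preceq>\<^bsub>E\<^esub> x) \<and>
    (\<forall>l\<in>carrier E. (\<forall>x\<in>S. l \<preceq>\<^bsub>E\<^esub> x) \<longrightarrow> l \<preceq>\<^bsub>E\<^esub> m)"

definition commutes :: "('a, 'm) seq_eff_alg_scheme \<Rightarrow> 'a \<Rightarrow> 'a \<Rightarrow> bool"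
  where "commutes E a b \<longleftrightarrow> a \<odot>\<^bsub>E\<^esub> b = b \<odot>\<^bsub>E\<^esub> a"

locale sequential_effect_algebra = effect_algebra E
  for E :: "('a, 'm) seq_eff_alg_scheme" (structure) +
  assumes sprod_closed: "\<lbrakk>a \<in> carrier E; b \<in> carrier E\<rbrakk> \<Longrightarrow> a \<odot> b \<in> carrier E"
    and sprod_esum:
      "\<lbrakk>a \<in> carrier E; b \<in> carrier E; c \<in> carrier E; b \<perp> c\<rbrakk>
        \<Longrightarrow> (a \<odot> b) \<perp> (a \<odot> c) \<and> a \<odot> (b \<boxplus> c) = (a \<odot> b) \<boxplus> (a \<odot> c)"
    and one_sprod: "a \<in> carrier E \<Longrightarrow> \<one>\<^sub>E \<odot> a = a"
    and sprod_zero_sym: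
      "\<lbrakk>a \<in> carrier E; b \<in> carrier E; a \<odot> b = \<zero>\<^sub>E\<rbrakk> \<Longrightarrow> b \<odot> a = \<zero>\<^sub>E"
    and commutes_compl:
      "\<lbrakk>a \<in> carrier E; b \<in> carrier E; commutes E a b\<rbrakk> \<Longrightarrow> commutes E a (ecompl E b)"
    and commutes_assoc:
      "\<lbrakk>a \<in> carrier E; b \<in> carrier E; c \<in> carrier E; commutes E a b\<rbrakk>
        \<Longrightarrow> a \<odot> (b \<odot> c) = (a \<odot> b) \<odot> c"
    and commutes_sprod:
      "\<lbrakk>a \<in> carrier E; b \<in> carrier E; c \<in> carrier E; commutes E c a; commutes E c b\<rbrakk>
        \<Longrightarrow> commutes E c (a \<odot> b)"
    and commutes_esum:
      "\<lbrakk>a \<in> carrier E; b \<in> carrier E; c \<in> carrier E; commutes E c a; commutes E c b; a \<perp> b\<rbrakk>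
        \<Longrightarrow> commutes E c (a \<boxplus> b)"

locale sigma_sea = sequential_effect_algebra E
  for E :: "('a, 'm) seq_eff_alg_scheme" (structure) +
  assumes ex_inf:
      "\<lbrakk>\<And>i::nat. a i \<in> carrier E; \<And>i. a (Suc i) \<preceq> a i\<rbrakk> \<Longrightarrow> \<exists>m. is_eff_inf E (range a) m"
    and sprod_inf:
      "\<lbrakk>\<And>i::nat. a i \<in> carrier E; \<And>i. a (Suc i) \<preceq> a i; b \<in> carrier E; is_eff_inf E (range a) m\<rbrakk>
        \<Longrightarrow> is_eff_inf E (range (\<lambda>i. b \<odot> a i)) (b \<odot> m)"
    and commutes_inf:
      "\<lbrakk>\<And>i::nat. a i \<in> carrier E; \<And>i. a (Suc i) \<preceq> a i; b \<in> carrier E; is_eff_inf E (range a) m;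
        \<And>i. commutes E b (a i)\<rbrakk> \<Longrightarrow> commutes E b m"

locale convex_effect_algebra = effect_algebra E
  for E :: "('a, 'm) eff_alg_scheme" (structure) +
  fixes scal :: "real \<Rightarrow> 'a \<Rightarrow> 'a" (infixr \<open>\<cdot>\<close> 75)
  assumes scal_closed: "\<lbrakk>r \<in> {0..1}; a \<in> carrier E\<rbrakk> \<Longrightarrow> r \<cdot> a \<in> carrier E"
    and scal_add:
      "\<lbrakk>r \<in> {0..1}; s \<in> {0..1}; r + s \<le> 1; a \<in> carrier E\<rbrakk>
        \<Longrightarrow> (r \<cdot> a) \<perp> (s \<cdot> a) \<and> (r \<cdot> a) \<boxplus> (s \<cdot> a) = (r + s) \<cdot> a"
    and scal_mult:
      "\<lbrakk>r \<in> {0..1}; s \<in> {0..1}; a \<in> carrier E\<rbrakk> \<Longrightarrow> (r * s) \<cdot> a = r \<cdot> (s \<cdot> a)"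
    and scal_zero: "a \<in> carrier E \<Longrightarrow> 0 \<cdot> a = \<zero>\<^sub>E"
    and scal_one: "a \<in> carrier E \<Longrightarrow> 1 \<cdot> a = a"
    and scal_esum:
      "\<lbrakk>r \<in> {0..1}; a \<in> carrier E; b \<in> carrier E; a \<perp> b\<rbrakk>
        \<Longrightarrow> (r \<cdot> a) \<perp> (r \<cdot> b) \<and> (r \<cdot> a) \<boxplus> (r \<cdot> b) = r \<cdot> (a \<boxplus> b)"

locale sequential_effect_space = sigma_sea E + convex_effect_algebra E scal
  for E :: "('a, 'm) seq_eff_alg_scheme" (structure)
    and scal :: "real \<Rightarrow> 'a \<Rightarrow> 'a" (infixr \<open>\<cdot>\<close> 75)

locale commutative_ses = sequential_effect_space E scal
  for E :: "('a, 'm) seq_eff_alg_scheme" (structure)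
    and scal :: "real \<Rightarrow> 'a \<Rightarrow> 'a" (infixr \<open>\<cdot>\<close> 75) +
  assumes all_commute: "\<lbrakk>a \<in> carrier E; b \<in> carrier E\<rbrakk> \<Longrightarrow> commutes E a b"

definition sea_iso ::
  "('a, 'm) seq_eff_alg_scheme \<Rightarrow> ('b, 'n) seq_eff_alg_scheme \<Rightarrow> ('a \<Rightarrow> 'b) \<Rightarrow> bool"
  where "sea_iso E F \<phi> \<longleftrightarrow>
    bij_betw \<phi> (carrier E) (carrier F) \<and>
    \<phi> \<zero>\<^sub>E\<^bsub>E\<^esub> = \<zero>\<^sub>E\<^bsub>F\<^esub> \<and> \<phi> \<one>\<^sub>E\<^bsub>E\<^esub> = \<one>\<^sub>E\<^bsub>F\<^esub> \<and>
    (\<forall>a\<in>carrier E. \<forall>b\<in>carrier E.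
      (a \<perp>\<^bsub>E\<^esub> b \<longleftrightarrow> \<phi> a \<perp>\<^bsub>F\<^esub> \<phi> b) \<and>
      (a \<perp>\<^bsub>E\<^esub> b \<longrightarrow> \<phi> (a \<boxplus>\<^bsub>E\<^esub> b) = \<phi> a \<boxplus>\<^bsub>F\<^esub> \<phi> b) \<and>
      \<phi> (a \<odot>\<^bsub>E\<^esub> b) = \<phi> a \<odot>\<^bsub>F\<^esub> \<phi> b)"

definition sea_isomorphic ::
  "('a, 'm) seq_eff_alg_scheme \<Rightarrow> ('b, 'n) seq_eff_alg_scheme \<Rightarrow> bool"
  where "sea_isomorphic E F \<longleftrightarrow> (\<exists>\<phi>. sea_iso E F \<phi>)"

text \<open>Functions on a space \<open>X\<close> are represented by their \<^const>\<open>extensional\<close> extension, so that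
  equality in the carrier is equality on \<open>topspace X\<close>.\<close>

definition cont_unit_interval :: "'x topology \<Rightarrow> ('x \<Rightarrow> real) seq_eff_alg"
  where "cont_unit_interval X =
    \<lparr> carrier = {f \<in> extensional (topspace X). continuous_map X euclideanreal f \<and>
                   (\<forall>x\<in>topspace X. 0 \<le> f x \<and> f x \<le> 1)},
      ezero = (\<lambda>x\<in>topspace X. 0),
      eone = (\<lambda>x\<in>topspace X. 1),
      orth = (\<lambda>f g. \<forall>x\<in>topspace X. f x + g x \<le> 1),
      esum = (\<lambda>f g. \<lambda>x\<in>topspace X. f x + g x),
      sprod = (\<lambda>f g. \<lambda>x\<in>topspace X. f x * g x) \<rparr>"

definition cont_scal :: "'x topology \<Rightarrow> real \<Rightarrow> ('x \<Rightarrow> real) \<Rightarrow> ('x \<Rightarrow> real)"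
  where "cont_scal X r f = (\<lambda>x\<in>topspace X. r * f x)"

definition zero_set_in :: "'x topology \<Rightarrow> 'x set \<Rightarrow> bool"
  where "zero_set_in X Z \<longleftrightarrow>
    (\<exists>f. continuous_map X euclideanreal f \<and> Z = {x \<in> topspace X. f x = 0})"

definition basically_disconnected :: "'x topology \<Rightarrow> bool"
  where "basically_disconnected X \<longleftrightarrow> (\<forall>Z. zero_set_in X Z \<longrightarrow> closedin X (X interior_of Z))"

end

(*
  Let E be a commutative sequential effect space. Call a preorder R on E a module preorder if it
  extends the order of E, is invariant under cancellable sums, scalars and multiplication by
  elements of E, and does not put 1 below 0. Given c, let s be the supremum of all r with
  r 1 below c. Forcing c to lie below s 1 as well keeps 1 from falling below 0, so in a maximal
  module preorder every c is equivalent to a scalar, and c |-> s is a multiplicative state. Starting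
  from the order of E itself, which is Archimedean because the infimum of 2^-n 1 is 0, this yields
  enough multiplicative states to determine the order. They form a compact space X, and
  E embeds in C(X); by Stone-Weierstrass its image is dense, and infima of decreasing sequences
  make it everything. Basic disconnectedness is then read off from the infimum of the functions
  max(0, 1 - n |h|), the indicator of the interior of the zero-set of h.

  Conversely, if closures of cozero-sets are open, the infimum of a sequence a_n is
  m(x) = inf {r. x in the closure of the union of the sets {a_n < r}}.
*)
theory Submission imports Defs
begin

section \<open>Effect algebras\<close>

text \<open>The sum is partial and scalars stop at 1, so inequalities can neither be added freely
  nor be divided or rearranged by subtraction. They are therefore stated with coefficients whose sum
  is at most 1, mostly powers of 1/2, which makes all sums in them defined; a common coefficient is
  cancelled at the end, ultimately by doubling. The order-theoretic argument is carried out inside E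
  in this way, without first building an ordered vector space around it. The supremum s of the
  scalars below c need not be attained in a given preorder, so every estimate from below works with
  scalars close to s. When a value is needed that scalars in [0, 1] cannot produce, such as 2 a -
  1/2, it is first formed at a small dyadic scale and then enlarged; the enlargement is possible
  because characters already decide which sums are defined.\<close>

lemma open_vimage_eval: "open U \<Longrightarrow> open ((\<lambda>h::'a \<Rightarrow> 'b::topological_space. h x) -` U)"
  by (rule open_vimage) (simp_all add: continuous_on_product_coordinates)

instance "fun" :: (type, t0_space) t0_space
proof
  fix f g :: "'a \<Rightarrow> 'b"
  assume "f \<noteq> g"
  then obtain x where x: "f x \<noteq> g x" by auto
  obtain U where "open U" "\<not> (f x \<in> U \<longleftrightarrow> g x \<in> U)"
    using x separation_t0[of "f x" "g x"] by auto
  then show "\<exists>U. open U \<and> \<not> (f \<in> U \<longleftrightarrow> g \<in> U)"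
    by (intro exI[of _ "(\<lambda>h. h x) -` U"]) (auto simp: open_vimage_eval)
qed

instance "fun" :: (type, t1_space) t1_space
proof
  fix f g :: "'a \<Rightarrow> 'b"
  assume "f \<noteq> g"
  then obtain x where x: "f x \<noteq> g x" by auto
  obtain U where "open U" "f x \<in> U" "g x \<notin> U"
    using x separation_t1[of "f x" "g x"] by auto
  then show "\<exists>U. open U \<and> f \<in> U \<and> g \<notin> U"
    by (intro exI[of _ "(\<lambda>h. h x) -` U"]) (auto simp: open_vimage_eval)
qed

text \<open>Multiplicative states are real functions on the carrier type, topologised by pointwise
  convergence. Stone-Weierstrass asks for a Hausdorff type of points, and the same instance makes
  the character space Hausdorff.\<close>

instance "fun" :: (type, t2_space) t2_space
proof
  fix f g :: "'a \<Rightarrow> 'b"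
  assume "f \<noteq> g"
  then obtain x where x: "f x \<noteq> g x" by auto
  obtain U V where "open U" "open V" "f x \<in> U" "g x \<in> V" "U \<inter> V = {}"
    using hausdorff[OF x] by auto
  then show "\<exists>U V. open U \<and> open V \<and> f \<in> U \<and> g \<in> V \<and> U \<inter> V = {}"
    by (intro exI[of _ "(\<lambda>h. h x) -` U"] exI[of _ "(\<lambda>h. h x) -` V"])
      (auto simp: open_vimage_eval)
qed

context effect_algebra
begin

lemma orth_sym: "\<lbrakk>x \<perp> y; x \<in> carrier E; y \<in> carrier E\<rbrakk> \<Longrightarrow> y \<perp> x"
  using esum_comm by blast

lemma esum_commute: "\<lbrakk>x \<perp> y; x \<in> carrier E; y \<in> carrier E\<rbrakk> \<Longrightarrow> x \<boxplus> y = y \<boxplus> x"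
  using esum_comm by blast

text \<open>The axiom moves brackets to the left only. Reversing the order of the three summands by
  commutativity turns the other direction into an instance of it.\<close>

lemma esum_assoc':
  assumes "x \<in> carrier E" "y \<in> carrier E" "z \<in> carrier E" "x \<perp> y" "(x \<boxplus> y) \<perp> z"
  shows "y \<perp> z \<and> x \<perp> (y \<boxplus> z) \<and> (x \<boxplus> y) \<boxplus> z = x \<boxplus> (y \<boxplus> z)"
proof -
  have 1: "y \<perp> x" "y \<boxplus> x = x \<boxplus> y" "x \<boxplus> y \<in> carrier E"
    using assms esum_comm esum_closed by auto
  then have 2: "z \<perp> (y \<boxplus> x)" "z \<boxplus> (y \<boxplus> x) = (x \<boxplus> y) \<boxplus> z"
    using assms orth_sym esum_commute[of "x \<boxplus> y" z] by auto
  have 3: "z \<perp> y" "(z \<boxplus> y) \<perp> x" "z \<boxplus> (y \<boxplus> x) = (z \<boxplus> y) \<boxplus> x"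
    using esum_assoc[of z y x] assms 1 2 by auto
  have 4: "y \<perp> z" "y \<boxplus> z = z \<boxplus> y" "z \<boxplus> y \<in> carrier E"
    using 3 assms orth_sym esum_commute esum_closed by auto
  then have "x \<perp> (y \<boxplus> z)" "x \<boxplus> (y \<boxplus> z) = (z \<boxplus> y) \<boxplus> x"
    using 3 assms orth_sym esum_commute[of "z \<boxplus> y" x] by auto
  then show ?thesis using 2 3 4 by simp
qed

lemma zero_orth: "x \<in> carrier E \<Longrightarrow> \<zero>\<^sub>E \<perp> x"
  using esum_zero zero_closed orth_sym by blast

lemma zero_esum: "x \<in> carrier E \<Longrightarrow> \<zero>\<^sub>E \<boxplus> x = x"
  using esum_zero zero_closed esum_commute[of x "\<zero>\<^sub>E"] by simp

lemma ecompl: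
  assumes "x \<in> carrier E"
  shows ecompl_closed: "ecompl E x \<in> carrier E"
    and orth_ecompl: "x \<perp> ecompl E x"
    and esum_ecompl: "x \<boxplus> ecompl E x = \<one>\<^sub>E"
  using theI'[OF ex1_compl[OF assms]] unfolding ecompl_def by auto

lemma ecompl_unique:
  "\<lbrakk>x \<in> carrier E; y \<in> carrier E; x \<perp> y; x \<boxplus> y = \<one>\<^sub>E\<rbrakk> \<Longrightarrow> ecompl E x = y"
  using ex1_compl[of x] ecompl[of x] by auto

lemma esum_swap_right:
  assumes "x \<in> carrier E" "y \<in> carrier E" "z \<in> carrier E" "x \<perp> y" "(x \<boxplus> y) \<perp> z"
  shows "x \<perp> z \<and> (x \<boxplus> z) \<perp> y \<and> (x \<boxplus> y) \<boxplus> z = (x \<boxplus> z) \<boxplus> y"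
proof -
  have 1: "y \<perp> z" "x \<perp> (y \<boxplus> z)" "(x \<boxplus> y) \<boxplus> z = x \<boxplus> (y \<boxplus> z)"
    using esum_assoc'[of x y z] assms by auto
  have 2: "z \<perp> y" "y \<boxplus> z = z \<boxplus> y"
    using 1 assms orth_sym esum_commute by auto
  show ?thesis using esum_assoc[of x z y] assms 1 2 by auto
qed

lemma esum_swap:
  assumes "a \<in> carrier E" "b \<in> carrier E" "c \<in> carrier E" "d \<in> carrier E"
    and "a \<perp> b" "c \<perp> d" "(a \<boxplus> b) \<perp> (c \<boxplus> d)"
  shows "a \<perp> c \<and> b \<perp> d \<and> (a \<boxplus> c) \<perp> (b \<boxplus> d) \<and> (a \<boxplus> b) \<boxplus> (c \<boxplus> d) = (a \<boxplus> c) \<boxplus> (b \<boxplus> d)"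
proof -
  have ab: "a \<boxplus> b \<in> carrier E" using assms esum_closed by simp
  have 1: "(a \<boxplus> b) \<perp> c" "((a \<boxplus> b) \<boxplus> c) \<perp> d" "(a \<boxplus> b) \<boxplus> (c \<boxplus> d) = ((a \<boxplus> b) \<boxplus> c) \<boxplus> d"
    using esum_assoc[of "a \<boxplus> b" c d] assms ab by auto
  have 2: "a \<perp> c" "(a \<boxplus> c) \<perp> b" "(a \<boxplus> b) \<boxplus> c = (a \<boxplus> c) \<boxplus> b"
    using esum_swap_right[of a b c] assms 1 by auto
  have "b \<perp> d \<and> (a \<boxplus> c) \<perp> (b \<boxplus> d) \<and> ((a \<boxplus> c) \<boxplus> b) \<boxplus> d = (a \<boxplus> c) \<boxplus> (b \<boxplus> d)"
    using esum_assoc'[of "a \<boxplus> c" b d] assms 1 2 esum_closed by simp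
  then show ?thesis using 1 2 by simp
qed

text \<open>With \<open>w\<close> the complement of the common value, both \<open>y\<close> and
  \<open>z\<close> are complements of \<open>x \<boxplus> w\<close>, and complements are
  unique.\<close>

lemma esum_cancel_right:
  assumes "x \<in> carrier E" "y \<in> carrier E" "z \<in> carrier E" "y \<perp> x" "z \<perp> x" "y \<boxplus> x = z \<boxplus> x"
  shows "y = z"
proof -
  define w where "w = ecompl E (y \<boxplus> x)"
  have w: "w \<in> carrier E" "(y \<boxplus> x) \<perp> w" "(y \<boxplus> x) \<boxplus> w = \<one>\<^sub>E"
    using assms esum_closed ecompl unfolding w_def by auto
  have y: "x \<perp> w" "y \<perp> (x \<boxplus> w)" "y \<boxplus> (x \<boxplus> w) = \<one>\<^sub>E"
    using esum_assoc'[of y x w] assms w by auto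
  have z: "z \<perp> (x \<boxplus> w)" "z \<boxplus> (x \<boxplus> w) = \<one>\<^sub>E"
    using esum_assoc'[of z x w] assms w by auto
  have xw: "x \<boxplus> w \<in> carrier E" using y assms w esum_closed by blast
  have "ecompl E (x \<boxplus> w) = y"
    using ecompl_unique[of "x \<boxplus> w" y] y xw assms orth_sym esum_commute[of y "x \<boxplus> w"] by simp
  moreover have "ecompl E (x \<boxplus> w) = z"
    using ecompl_unique[of "x \<boxplus> w" z] z xw assms orth_sym esum_commute[of z "x \<boxplus> w"] by simp
  ultimately show ?thesis by simp
qed

lemma esum_cancel_left:
  assumes "x \<in> carrier E" "y \<in> carrier E" "z \<in> carrier E" "x \<perp> y" "x \<perp> z" "x \<boxplus> y = x \<boxplus> z"
  shows "y = z"
  using esum_cancel_right[of x y z] assms orth_sym esum_commute[of x y] esum_commute[of x z] by simp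

text \<open>A sum equal to 0 is orthogonal to 1; reassociating
  \<open>(y \<boxplus> x) \<boxplus> \<one>\<^sub>E\<close> makes \<open>x\<close> itself orthogonal
  to 1, which only 0 is.\<close>

lemma esum_eq_zero:
  assumes "x \<in> carrier E" "y \<in> carrier E" "x \<perp> y" "x \<boxplus> y = \<zero>\<^sub>E"
  shows "x = \<zero>\<^sub>E"
proof -
  have "y \<perp> x" "y \<boxplus> x = \<zero>\<^sub>E" using assms orth_sym esum_commute[of x y] by auto
  then have "x \<perp> \<one>\<^sub>E"
    using esum_assoc'[of y x "\<one>\<^sub>E"] assms one_closed zero_orth by auto
  then show ?thesis using orth_one assms by blast
qed

lemma eff_leI: "\<lbrakk>z \<in> carrier E; x \<perp> z; x \<boxplus> z = y\<rbrakk> \<Longrightarrow> x \<preceq> y"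
  unfolding eff_le_def by blast

lemma eff_leE:
  assumes "x \<preceq> y" obtains z where "z \<in> carrier E" "x \<perp> z" "x \<boxplus> z = y"
  using assms unfolding eff_le_def by blast

lemma eff_le_refl: "x \<in> carrier E \<Longrightarrow> x \<preceq> x"
  using eff_leI[of "\<zero>\<^sub>E" x x] esum_zero zero_closed by blast

lemma zero_le: "x \<in> carrier E \<Longrightarrow> \<zero>\<^sub>E \<preceq> x"
  using eff_leI[of x "\<zero>\<^sub>E" x] zero_esum zero_orth by blast

lemma le_one: "x \<in> carrier E \<Longrightarrow> x \<preceq> \<one>\<^sub>E"
  using eff_leI ecompl by blast

lemma le_esum: "\<lbrakk>x \<perp> y; x \<in> carrier E; y \<in> carrier E\<rbrakk> \<Longrightarrow> x \<preceq> x \<boxplus> y"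
  using eff_leI by blast

lemma eff_le_trans:
  assumes "x \<preceq> y" "y \<preceq> z" "x \<in> carrier E"
  shows "x \<preceq> z"
proof -
  obtain u where u: "u \<in> carrier E" "x \<perp> u" "x \<boxplus> u = y" using assms eff_leE by blast
  obtain v where v: "v \<in> carrier E" "y \<perp> v" "y \<boxplus> v = z" using assms eff_leE by blast
  show ?thesis
    using eff_leI[of "u \<boxplus> v" x z] esum_assoc'[of x u v] u v assms esum_closed by auto
qed

lemma eff_le_antisym:
  assumes "x \<preceq> y" "y \<preceq> x" "x \<in> carrier E"
  shows "x = y"
proof -
  obtain u where u: "u \<in> carrier E" "x \<perp> u" "x \<boxplus> u = y" using assms eff_leE by blast
  obtain v where v: "v \<in> carrier E" "y \<perp> v" "y \<boxplus> v = x" using assms eff_leE by blast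
  have uv: "u \<perp> v" "x \<perp> (u \<boxplus> v)" "x \<boxplus> (u \<boxplus> v) = x \<boxplus> \<zero>\<^sub>E"
    using esum_assoc'[of x u v] u v assms esum_zero by auto
  then have "u \<boxplus> v = \<zero>\<^sub>E"
    using esum_cancel_left[of x "u \<boxplus> v" "\<zero>\<^sub>E"] esum_zero zero_closed assms esum_closed u v by simp
  then have "u = \<zero>\<^sub>E" using esum_eq_zero u v uv by blast
  then show ?thesis using u esum_zero assms by simp
qed

lemma orth_mono_left:
  assumes "x \<preceq> u" "u \<perp> y" "x \<in> carrier E" "y \<in> carrier E"
  shows "x \<perp> y"
proof -
  obtain d where d: "d \<in> carrier E" "x \<perp> d" "x \<boxplus> d = u" using assms eff_leE by blast
  then show ?thesis using esum_swap_right[of x d y] assms by simp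
qed

lemma orth_mono:
  assumes "x \<preceq> u" "y \<preceq> v" "u \<perp> v"
    and "x \<in> carrier E" "y \<in> carrier E" "u \<in> carrier E" "v \<in> carrier E"
  shows "x \<perp> y"
  using orth_mono_left[of y v x] orth_mono_left[of x u v] assms orth_sym by blast

text \<open>Turns definedness of a sum into an order statement, so that whatever detects the order
  also detects orthogonality.\<close>

lemma orth_iff_le_ecompl:
  assumes "x \<in> carrier E" "y \<in> carrier E"
  shows "x \<perp> y \<longleftrightarrow> x \<preceq> ecompl E y"
proof
  assume xy: "x \<perp> y"
  define z where "z = ecompl E (x \<boxplus> y)"
  have z: "z \<in> carrier E" "(x \<boxplus> y) \<perp> z" "(x \<boxplus> y) \<boxplus> z = \<one>\<^sub>E"
    using assms xy esum_closed ecompl unfolding z_def by auto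
  have xz: "x \<perp> z" "(x \<boxplus> z) \<perp> y" "(x \<boxplus> z) \<boxplus> y = \<one>\<^sub>E"
    using esum_swap_right[of x y z] assms z xy by auto
  have "ecompl E y = x \<boxplus> z"
    using ecompl_unique[of y "x \<boxplus> z"] xz assms z orth_sym esum_closed
      esum_commute[of "x \<boxplus> z" y] by simp
  then show "x \<preceq> ecompl E y" using eff_leI[of z x] xz z by simp
next
  assume "x \<preceq> ecompl E y"
  then show "x \<perp> y"
    using orth_mono_left[of x "ecompl E y" y] ecompl orth_sym assms by blast
qed

lemma esum_mono:
  assumes "x \<preceq> u" "y \<preceq> v" "u \<perp> v"
    and "x \<in> carrier E" "y \<in> carrier E"
  shows "x \<boxplus> y \<preceq> u \<boxplus> v"
proof -
  obtain a where a: "a \<in> carrier E" "x \<perp> a" "x \<boxplus> a = u" using assms eff_leE by blast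
  obtain b where b: "b \<in> carrier E" "y \<perp> b" "y \<boxplus> b = v" using assms eff_leE by blast
  show ?thesis
    using esum_swap[of x a y b] a b assms esum_closed eff_leI[of "a \<boxplus> b" "x \<boxplus> y" "u \<boxplus> v"] by simp
qed

lemma esum_le_cancel:
  assumes "x \<boxplus> z \<preceq> y \<boxplus> z" "x \<perp> z" "y \<perp> z"
    and "x \<in> carrier E" "y \<in> carrier E" "z \<in> carrier E"
  shows "x \<preceq> y"
proof -
  obtain u where u: "u \<in> carrier E" "(x \<boxplus> z) \<perp> u" "(x \<boxplus> z) \<boxplus> u = y \<boxplus> z"
    using assms eff_leE by blast
  then have *: "x \<perp> u" "(x \<boxplus> u) \<perp> z" "(x \<boxplus> u) \<boxplus> z = y \<boxplus> z"
    using esum_swap_right[of x z u] assms by auto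
  then have "x \<boxplus> u = y" using esum_cancel_right[of z "x \<boxplus> u" y] assms u esum_closed by simp
  then show ?thesis using eff_leI u * by blast
qed

end

section \<open>Scalars and the Archimedean property\<close>

context convex_effect_algebra
begin

lemma scal_zero_right:
  assumes "r \<in> {0..1}"
  shows "r \<cdot> \<zero>\<^sub>E = \<zero>\<^sub>E"
proof -
  have c: "r \<cdot> \<zero>\<^sub>E \<in> carrier E" using assms scal_closed zero_closed by blast
  have "(r \<cdot> \<zero>\<^sub>E) \<perp> (r \<cdot> \<zero>\<^sub>E)" "(r \<cdot> \<zero>\<^sub>E) \<boxplus> (r \<cdot> \<zero>\<^sub>E) = (r \<cdot> \<zero>\<^sub>E) \<boxplus> \<zero>\<^sub>E"
    using scal_esum[of r "\<zero>\<^sub>E" "\<zero>\<^sub>E"] assms zero_closed esum_zero c by auto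
  then show ?thesis
    using esum_cancel_left[of "r \<cdot> \<zero>\<^sub>E" "r \<cdot> \<zero>\<^sub>E" "\<zero>\<^sub>E"] c zero_closed esum_zero by simp
qed

lemma scal_mono:
  assumes "a \<preceq> b" "r \<in> {0..1}" "a \<in> carrier E"
  shows "r \<cdot> a \<preceq> r \<cdot> b"
proof -
  obtain z where z: "z \<in> carrier E" "a \<perp> z" "a \<boxplus> z = b" using assms eff_leE by blast
  then show ?thesis
    using scal_esum[of r a z] scal_closed[of r z] assms eff_leI[of "r \<cdot> z"] by simp
qed

lemma scal_mono_left:
  assumes "r \<le> s" "0 \<le> r" "s \<le> 1" "a \<in> carrier E"
  shows "r \<cdot> a \<preceq> s \<cdot> a"
  using scal_add[of r "s - r" a] scal_closed[of "s - r" a] assms eff_leI[of "(s - r) \<cdot> a"] by simp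

lemma scal_orth:
  assumes "r \<in> {0..1}" "s \<in> {0..1}" "r + s \<le> 1" "a \<in> carrier E" "b \<in> carrier E"
  shows "(r \<cdot> a) \<perp> (s \<cdot> b)"
proof (rule orth_mono)
  show "r \<cdot> a \<preceq> r \<cdot> \<one>\<^sub>E" "s \<cdot> b \<preceq> s \<cdot> \<one>\<^sub>E"
    using assms scal_mono le_one by auto
  show "(r \<cdot> \<one>\<^sub>E) \<perp> (s \<cdot> \<one>\<^sub>E)"
    using assms scal_add one_closed by blast
qed (use assms scal_closed one_closed in auto)

lemma half_esum_half: "a \<in> carrier E \<Longrightarrow> (1/2) \<cdot> a \<boxplus> (1/2) \<cdot> a = a"
  using scal_add[of "1/2" "1/2" a] scal_one by simp

lemma half_double:
  assumes "a \<in> carrier E" "a \<perp> a"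
  shows "(1/2) \<cdot> (a \<boxplus> a) = a"
  using scal_esum[of "1/2" a a] assms half_esum_half by simp

lemma half_le_cancel:
  assumes "(1/2) \<cdot> a \<preceq> (1/2) \<cdot> b" "a \<in> carrier E" "b \<in> carrier E"
  shows "a \<preceq> b"
  using esum_mono[of "(1/2) \<cdot> a" "(1/2) \<cdot> b" "(1/2) \<cdot> a" "(1/2) \<cdot> b"] assms
    scal_orth[of "1/2" "1/2" b b] scal_closed half_esum_half by simp

lemma scal_le_cancel:
  assumes "r \<cdot> a \<preceq> r \<cdot> b" "0 < r" "r \<le> 1" "a \<in> carrier E" "b \<in> carrier E"
  shows "a \<preceq> b"
proof -
  obtain n where n: "(1/2::real)^n < r"
    using real_arch_pow_inv[of r "1/2"] assms by auto
  have "((1/2)^n / r) \<cdot> r \<cdot> a \<preceq> ((1/2)^n / r) \<cdot> r \<cdot> b"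
    by (rule scal_mono) (use assms n scal_closed in auto)
  then have *: "((1/2)^n) \<cdot> a \<preceq> ((1/2)^n) \<cdot> b"
    using scal_mult[of "(1/2)^n / r" r a] scal_mult[of "(1/2)^n / r" r b] assms n by simp
  have "((1/2)^m) \<cdot> a \<preceq> ((1/2)^m) \<cdot> b \<Longrightarrow> a \<preceq> b" for m
  proof (induction m)
    case 0
    then show ?case using scal_one assms by simp
  next
    case (Suc m)
    have "(1/2) \<cdot> (1/2)^m \<cdot> a \<preceq> (1/2) \<cdot> (1/2)^m \<cdot> b"
      using Suc.prems scal_mult[of "1/2" "(1/2)^m"] assms by (simp add: power_le_one)
    then show ?case using Suc.IH half_le_cancel scal_closed assms by (simp add: power_le_one)
  qed
  then show ?thesis using * by blast
qed

end

context sequential_effect_space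
begin

text \<open>The infimum m of the elements 2^-(n+1) 1 absorbs doubling: each of them is twice the
  next, so m + m is again a lower bound. Hence m + m \<le> m, and cancelling gives m = 0.\<close>

lemma le_dyadic_imp_zero:
  assumes "d \<in> carrier E" "\<And>n. d \<preceq> ((1/2)^Suc n) \<cdot> \<one>\<^sub>E"
  shows "d = \<zero>\<^sub>E"
proof -
  define u where "u n = ((1/2)^Suc n) \<cdot> \<one>\<^sub>E" for n
  have p: "(1/2::real)^Suc n \<in> {0..1}" for n
    using power_le_one[of "1/2::real" "Suc n"] by simp
  have u: "u n \<in> carrier E" for n unfolding u_def using scal_closed one_closed p by blast
  have uu: "u (Suc n) \<perp> u (Suc n)" "u (Suc n) \<boxplus> u (Suc n) = u n" for n
  proof -
    have "(1/2::real)^Suc (Suc n) + (1/2)^Suc (Suc n) = (1/2)^Suc n" by simp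
    then show "u (Suc n) \<perp> u (Suc n)" "u (Suc n) \<boxplus> u (Suc n) = u n"
      unfolding u_def using scal_add[OF p[of "Suc n"] p[of "Suc n"] _ one_closed] p[of n]
      by (metis atLeastAtMost_iff)+
  qed
  then have "u (Suc n) \<preceq> u n" for n using u le_esum by metis
  then obtain m where m: "is_eff_inf E (range u) m"
    using ex_inf[of u] u by blast
  have mc: "m \<in> carrier E" and mle: "\<And>n. m \<preceq> u n"
    and mg: "\<And>l. l \<in> carrier E \<Longrightarrow> (\<And>n. l \<preceq> u n) \<Longrightarrow> l \<preceq> m"
    using m unfolding is_eff_inf_def by auto
  have mm: "m \<perp> m" using orth_mono[OF mle mle uu(1) mc mc u u] .
  have "m \<boxplus> m \<preceq> u n" for n
    using esum_mono[OF mle mle uu(1) mc mc] uu(2) by simp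
  then have "m \<boxplus> m \<preceq> m" using mg esum_closed mm mc by blast
  then have "m \<boxplus> m = m \<boxplus> \<zero>\<^sub>E"
    using eff_le_antisym le_esum[OF mm mc mc] mm mc esum_closed esum_zero by simp
  then have "m = \<zero>\<^sub>E" using esum_cancel_left[OF mc mc zero_closed mm] esum_zero mc by simp
  then have "d \<preceq> \<zero>\<^sub>E" using mg assms unfolding u_def by blast
  then show ?thesis using eff_le_antisym zero_le assms by blast
qed

text \<open>Halving keeps the right-hand sums defined, as 1/2 + 2^-(n+1) \<le> 1. With h half of b,
  the infimum of the elements h + 2^-(n+1) 1 has the form h + d; cancelling h bounds d by every
  2^-(n+1) 1, so the infimum is h itself.\<close>

lemma archimedean:
  assumes a: "a \<in> carrier E" and b: "b \<in> carrier E"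
    and le: "\<And>n. (1/2) \<cdot> a \<preceq> (1/2) \<cdot> b \<boxplus> ((1/2)^Suc n) \<cdot> \<one>\<^sub>E"
  shows "a \<preceq> b"
proof -
  define h where "h = (1/2) \<cdot> b"
  define u where "u n = ((1/2)^Suc n) \<cdot> \<one>\<^sub>E" for n
  have p: "(1/2::real)^Suc n \<in> {0..1}" "(1/2::real)^Suc n \<le> 1/2" for n
    using power_le_one[of "1/2::real" n] by simp_all
  have u: "u n \<in> carrier E" for n unfolding u_def using scal_closed one_closed p by blast
  have h: "h \<in> carrier E" unfolding h_def using scal_closed b by simp
  have o: "h \<perp> u n" for n
    unfolding h_def u_def by (rule scal_orth) (use b one_closed p[of n] in auto)
  have "u (Suc n) \<preceq> u n" for n
    unfolding u_def by (rule scal_mono_left) (use p[of n] one_closed in simp_all)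
  then have "h \<boxplus> u (Suc n) \<preceq> h \<boxplus> u n" for n
    using esum_mono[of h h "u (Suc n)" "u n"] eff_le_refl o h u by blast
  then obtain m where m: "is_eff_inf E (range (\<lambda>n. h \<boxplus> u n)) m"
    using ex_inf[of "\<lambda>n. h \<boxplus> u n"] esum_closed[OF h u o] by blast
  have mc: "m \<in> carrier E" and mle: "\<And>n. m \<preceq> h \<boxplus> u n"
    and mg: "\<And>l. l \<in> carrier E \<Longrightarrow> (\<And>n. l \<preceq> h \<boxplus> u n) \<Longrightarrow> l \<preceq> m"
    using m unfolding is_eff_inf_def by auto
  have "h \<preceq> m" using mg h le_esum[OF o h u] by blast
  then obtain d where d: "d \<in> carrier E" "h \<perp> d" "h \<boxplus> d = m" using eff_leE by blast
  have "d \<preceq> u n" for n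
    using mle[of n] d h u[of n] o[of n] orth_sym esum_commute[of h d] esum_commute[of h "u n"]
      esum_le_cancel[of d h "u n"] by simp
  then have "d = \<zero>\<^sub>E" using le_dyadic_imp_zero d unfolding u_def by blast
  then have "m = h" using d esum_zero h by simp
  moreover have "(1/2) \<cdot> a \<preceq> m" using mg le scal_closed a unfolding h_def u_def by simp
  ultimately show ?thesis using half_le_cancel a b unfolding h_def by blast
qed

end

section \<open>Homogeneity of the sequential product\<close>

context commutative_ses
begin

lemma sprod_commute: "\<lbrakk>a \<in> carrier E; b \<in> carrier E\<rbrakk> \<Longrightarrow> a \<odot> b = b \<odot> a"
  using all_commute unfolding commutes_def by blast

lemma sprod_assoc:
  "\<lbrakk>a \<in> carrier E; b \<in> carrier E; c \<in> carrier E\<rbrakk> \<Longrightarrow> a \<odot> (b \<odot> c) = (a \<odot> b) \<odot> c"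
  using commutes_assoc all_commute by blast

lemma sprod_one: "a \<in> carrier E \<Longrightarrow> a \<odot> \<one>\<^sub>E = a"
  using sprod_commute[of a "\<one>\<^sub>E"] one_sprod one_closed by simp

lemma sprod_zero:
  assumes "a \<in> carrier E"
  shows "a \<odot> \<zero>\<^sub>E = \<zero>\<^sub>E"
proof -
  have c: "a \<odot> \<zero>\<^sub>E \<in> carrier E" using assms sprod_closed zero_closed by blast
  have "(a \<odot> \<zero>\<^sub>E) \<perp> (a \<odot> \<zero>\<^sub>E)" "(a \<odot> \<zero>\<^sub>E) \<boxplus> (a \<odot> \<zero>\<^sub>E) = (a \<odot> \<zero>\<^sub>E) \<boxplus> \<zero>\<^sub>E"
    using sprod_esum[of a "\<zero>\<^sub>E" "\<zero>\<^sub>E"] assms zero_closed esum_zero c by auto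
  then show ?thesis
    using esum_cancel_left[of "a \<odot> \<zero>\<^sub>E" "a \<odot> \<zero>\<^sub>E" "\<zero>\<^sub>E"] c zero_closed esum_zero by simp
qed

lemma sprod_esum_left:
  assumes "a \<in> carrier E" "b \<in> carrier E" "c \<in> carrier E" "b \<perp> c"
  shows "(b \<odot> a) \<perp> (c \<odot> a) \<and> (b \<boxplus> c) \<odot> a = (b \<odot> a) \<boxplus> (c \<odot> a)"
  using sprod_esum[of a b c] assms esum_closed sprod_commute by simp

lemma sprod_mono:
  assumes "b \<preceq> c" "a \<in> carrier E" "b \<in> carrier E"
  shows "a \<odot> b \<preceq> a \<odot> c"
proof -
  obtain z where z: "z \<in> carrier E" "b \<perp> z" "b \<boxplus> z = c" using assms eff_leE by blast
  then show ?thesis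
    using sprod_esum[of a b z] sprod_closed[of a z] assms eff_leI[of "a \<odot> z"] by simp
qed

lemma sprod_le: "\<lbrakk>a \<in> carrier E; b \<in> carrier E\<rbrakk> \<Longrightarrow> a \<odot> b \<preceq> a"
  using sprod_mono[of b "\<one>\<^sub>E" a] le_one sprod_one by simp

text \<open>The axioms relate the product to sums but not to scalars. Additivity settles powers of
  1/2 by halving and dyadic multiples by repeated addition; a general r is enclosed between a dyadic
  d and d + 2^-n, and the Archimedean property removes the gap.\<close>

lemma sprod_scal:
  assumes a: "a \<in> carrier E" and b: "b \<in> carrier E" and r: "r \<in> {0..1}"
  shows "a \<odot> (r \<cdot> b) = r \<cdot> (a \<odot> b)"
proof -
  define y where "y = a \<odot> b"
  define f where "f s = a \<odot> (s \<cdot> b)" for s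
  have y: "y \<in> carrier E" unfolding y_def using a b sprod_closed by blast
  have f: "f s \<in> carrier E" if "s \<in> {0..1}" for s
    unfolding f_def using a b sprod_closed scal_closed that by blast
  have fadd: "f s \<perp> f t \<and> f (s + t) = f s \<boxplus> f t" if "s \<in> {0..1}" "t \<in> {0..1}" "s + t \<le> 1" for s t
    using sprod_esum[of a "s \<cdot> b" "t \<cdot> b"] scal_add[of s t b] scal_closed that a b
    unfolding f_def by simp
  have pw: "(1/2::real)^n \<in> {0..1}" for n by (simp add: power_le_one)
  have fpow: "f ((1/2)^n) = ((1/2)^n) \<cdot> y" for n
  proof (induction n)
    case 0
    then show ?case unfolding f_def y_def using scal_one a b sprod_closed by simp
  next
    case (Suc n)
    have "f ((1/2)^Suc n) \<perp> f ((1/2)^Suc n)" "f ((1/2)^n) = f ((1/2)^Suc n) \<boxplus> f ((1/2)^Suc n)"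
      using fadd[OF pw pw, of "Suc n" "Suc n"] by (simp_all add: power_le_one)
    then have "f ((1/2)^Suc n) = (1/2) \<cdot> f ((1/2)^n)"
      using half_double f[OF pw, of "Suc n"] by simp
    also have "\<dots> = ((1/2)^Suc n) \<cdot> y"
      using scal_mult[of "1/2" "(1/2)^n" y] pw Suc y by simp
    finally show ?case .
  qed
  have fdy: "f (k * (1/2)^n) = (k * (1/2)^n) \<cdot> y" if "real k * (1/2)^n \<le> 1" for k n :: nat
    using that
  proof (induction k)
    case 0
    then show ?case using scal_zero y sprod_zero a b unfolding f_def by simp
  next
    case (Suc k)
    have s: "real (Suc k) * (1/2)^n = k * (1/2)^n + (1/2)^n" by (simp add: algebra_simps)
    have k: "real k * (1/2)^n \<in> {0..1}"
      using Suc.prems pw[of n] unfolding s atLeastAtMost_iff by (metis add_increasing2 add_le_cancel_left le_add_same_cancel1 mult_nonneg_nonneg of_nat_0_le_iff order_trans)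
    have le: "real k * (1/2)^n + (1/2)^n \<le> 1" using Suc.prems unfolding s .
    show ?case
      using Suc.IH fadd[OF k pw le] scal_add[OF k pw le y] k fpow unfolding s by simp
  qed
  have approx: "\<exists>d\<in>{0..1}. d \<le> r \<and> r \<le> d + (1/2)^n \<and> f d = d \<cdot> y" for n
  proof -
    define k where "k = nat \<lfloor>r * 2^n\<rfloor>"
    have "0 \<le> \<lfloor>r * 2^n\<rfloor>" using r by simp
    then have k: "real k = of_int \<lfloor>r * 2^n\<rfloor>" unfolding k_def by simp
    have "real k \<le> r * 2^n" "r * 2^n \<le> real k + 1" unfolding k by linarith+
    then have "real k * (1/2)^n \<le> r" "r \<le> real k * (1/2)^n + (1/2)^n"
      by (simp_all add: power_one_over field_simps)
    then show ?thesis using fdy[of k n] r by (intro bexI[of _ "real k * (1/2)^n"]) auto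
  qed
  \<comment> \<open>The remainder r - d need not be dyadic, so \<open>f (r - d)\<close> is bounded
    through monotonicity, by the value of \<open>f\<close> at 2^-n.\<close>
  have fsmall: "f s \<preceq> ((1/2)^n) \<cdot> \<one>\<^sub>E" if "0 \<le> s" "s \<le> (1/2)^n" for s n
  proof -
    have s: "s \<in> {0..1}" using that pw[of n] by auto
    have "f s \<preceq> f ((1/2)^n)"
      unfolding f_def using s that pw[of n] a b scal_closed by (intro sprod_mono scal_mono_left) auto
    moreover have "f ((1/2)^n) \<preceq> ((1/2)^n) \<cdot> \<one>\<^sub>E"
      unfolding fpow using scal_mono[OF le_one[OF y] pw y] .
    ultimately show ?thesis using eff_le_trans f s by blast
  qed
  have half_pow: "(1/2) \<cdot> ((1/2)^n) \<cdot> \<one>\<^sub>E = ((1/2)^Suc n) \<cdot> \<one>\<^sub>E" for n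
    using scal_mult[of "1/2" "(1/2)^n" "\<one>\<^sub>E"] pw one_closed by simp
  have pc: "((1/2)^n) \<cdot> \<one>\<^sub>E \<in> carrier E" for n using pw one_closed scal_closed by blast
  have ho: "(1/2) \<cdot> u \<perp> (1/2) \<cdot> v" if "u \<in> carrier E" "v \<in> carrier E" for u v
    using scal_orth that by simp
  have hc: "(1/2) \<cdot> u \<in> carrier E" if "u \<in> carrier E" for u using scal_closed that by simp
  have ry: "r \<cdot> y \<in> carrier E" using scal_closed r y by blast
  have "f r \<preceq> r \<cdot> y"
  proof (rule archimedean[OF f[OF r] ry])
    fix n
    obtain d where d: "d \<in> {0..1}" "d \<le> r" "r \<le> d + (1/2)^n" "f d = d \<cdot> y" using approx by blast
    have rd: "r - d \<in> {0..1}" using d r by auto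
    have "f d \<perp> f (r - d)" "f r = f d \<boxplus> f (r - d)" using fadd[OF d(1) rd] r by auto
    then have "(1/2) \<cdot> f r = (1/2) \<cdot> d \<cdot> y \<boxplus> (1/2) \<cdot> f (r - d)"
      using scal_esum[of "1/2" "f d" "f (r - d)"] f[OF d(1)] f[OF rd] d(4) by simp
    also have "\<dots> \<preceq> (1/2) \<cdot> r \<cdot> y \<boxplus> (1/2) \<cdot> ((1/2)^n) \<cdot> \<one>\<^sub>E"
      using d r y f rd ry pc hc scal_closed fsmall[of "r - d" n]
      by (intro esum_mono ho scal_mono scal_mono_left) auto
    finally show "(1/2) \<cdot> f r \<preceq> (1/2) \<cdot> r \<cdot> y \<boxplus> ((1/2)^Suc n) \<cdot> \<one>\<^sub>E"
      unfolding half_pow .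
  qed
  moreover have "r \<cdot> y \<preceq> f r"
  proof (rule archimedean[OF ry f[OF r]])
    fix n
    obtain d where d: "d \<in> {0..1}" "d \<le> r" "r \<le> d + (1/2)^n" "f d = d \<cdot> y" using approx by blast
    have rd: "r - d \<in> {0..1}" using d r by auto
    have dy: "d \<cdot> y \<in> carrier E" "(r - d) \<cdot> y \<in> carrier E" using scal_closed d rd y by auto
    have "f d \<perp> f (r - d)" "f r = f d \<boxplus> f (r - d)" using fadd[OF d(1) rd] r by auto
    then have le: "d \<cdot> y \<preceq> f r" using le_esum f d rd by metis
    have "(r - d) \<cdot> y \<preceq> ((1/2)^n) \<cdot> y" using d pw[of n] y rd by (intro scal_mono_left) auto
    moreover have "((1/2)^n) \<cdot> y \<preceq> ((1/2)^n) \<cdot> \<one>\<^sub>E" using scal_mono[OF le_one[OF y] pw y] .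
    ultimately have small: "(r - d) \<cdot> y \<preceq> ((1/2)^n) \<cdot> \<one>\<^sub>E" using eff_le_trans dy by blast
    have "(1/2) \<cdot> r \<cdot> y = (1/2) \<cdot> d \<cdot> y \<boxplus> (1/2) \<cdot> (r - d) \<cdot> y"
      using scal_esum[of "1/2" "d \<cdot> y" "(r - d) \<cdot> y"] scal_add[OF d(1) rd _ y] r dy by simp
    also have "\<dots> \<preceq> (1/2) \<cdot> f r \<boxplus> (1/2) \<cdot> ((1/2)^n) \<cdot> \<one>\<^sub>E"
      using f r dy pc hc le small by (intro esum_mono ho scal_mono) auto
    finally show "(1/2) \<cdot> r \<cdot> y \<preceq> (1/2) \<cdot> f r \<boxplus> ((1/2)^Suc n) \<cdot> \<one>\<^sub>E"
      unfolding half_pow .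
  qed
  ultimately show ?thesis using eff_le_antisym f r unfolding f_def y_def by blast
qed

end

section \<open>Module preorders\<close>

context convex_effect_algebra
begin

lemma mix_closed:
  "\<lbrakk>r \<in> {0..1}; s \<in> {0..1}; r + s \<le> 1; a \<in> carrier E; b \<in> carrier E\<rbrakk>
    \<Longrightarrow> r \<cdot> a \<boxplus> s \<cdot> b \<in> carrier E"
  by (simp add: scal_orth scal_closed esum_closed)

lemma scal_mix:
  assumes "t \<in> {0..1}" "r \<in> {0..1}" "s \<in> {0..1}" "r + s \<le> 1" "a \<in> carrier E" "b \<in> carrier E"
  shows "t \<cdot> (r \<cdot> a \<boxplus> s \<cdot> b) = (t * r) \<cdot> a \<boxplus> (t * s) \<cdot> b"
  using scal_esum[of t "r \<cdot> a" "s \<cdot> b"] scal_orth[of r s a b] scal_closed scal_mult assms by simp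

lemma mix_mono:
  assumes "a \<preceq> b" "c \<preceq> d" "r \<in> {0..1}" "s \<in> {0..1}" "r + s \<le> 1"
    and "a \<in> carrier E" "b \<in> carrier E" "c \<in> carrier E" "d \<in> carrier E"
  shows "r \<cdot> a \<boxplus> s \<cdot> c \<preceq> r \<cdot> b \<boxplus> s \<cdot> d"
  using assms by (intro esum_mono scal_mono scal_orth scal_closed) auto

end

context commutative_ses
begin

lemma scal_sprod:
  "\<lbrakk>a \<in> carrier E; b \<in> carrier E; r \<in> {0..1}\<rbrakk> \<Longrightarrow> (r \<cdot> a) \<odot> b = r \<cdot> (a \<odot> b)"
  using sprod_scal[of b a r] sprod_commute[of "r \<cdot> a" b] sprod_commute[of b a] scal_closed by simp

lemma sprod_mix:
  assumes "p \<in> carrier E" "r \<in> {0..1}" "s \<in> {0..1}" "r + s \<le> 1" "a \<in> carrier E" "b \<in> carrier E"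
  shows "p \<odot> (r \<cdot> a \<boxplus> s \<cdot> b) = r \<cdot> (p \<odot> a) \<boxplus> s \<cdot> (p \<odot> b)"
  using sprod_esum[of p "r \<cdot> a" "s \<cdot> b"] scal_orth[of r s a b] scal_closed sprod_scal assms by simp

end

locale module_preorder = commutative_ses E scal
  for E :: "('a, 'm) seq_eff_alg_scheme" (structure)
    and scal :: "real \<Rightarrow> 'a \<Rightarrow> 'a" (infixr \<open>\<cdot>\<close> 75) +
  fixes R :: "('a \<times> 'a) set"
  assumes rel_closed: "(a, b) \<in> R \<Longrightarrow> a \<in> carrier E \<and> b \<in> carrier E"
    and le_rel: "\<lbrakk>a \<preceq> b; a \<in> carrier E; b \<in> carrier E\<rbrakk> \<Longrightarrow> (a, b) \<in> R"
    and rel_trans: "\<lbrakk>(a, b) \<in> R; (b, c) \<in> R\<rbrakk> \<Longrightarrow> (a, c) \<in> R"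
    and rel_esum_right: "\<lbrakk>a \<perp> c; b \<perp> c; a \<in> carrier E; b \<in> carrier E; c \<in> carrier E\<rbrakk>
        \<Longrightarrow> (a \<boxplus> c, b \<boxplus> c) \<in> R \<longleftrightarrow> (a, b) \<in> R"
    and rel_sprod: "\<lbrakk>(a, b) \<in> R; p \<in> carrier E\<rbrakk> \<Longrightarrow> (p \<odot> a, p \<odot> b) \<in> R"
    and rel_scal_cancel: "\<lbrakk>(r \<cdot> a, r \<cdot> b) \<in> R; 0 < r; r \<le> 1; a \<in> carrier E; b \<in> carrier E\<rbrakk>
        \<Longrightarrow> (a, b) \<in> R"
    and rel_proper: "(\<one>\<^sub>E, \<zero>\<^sub>E) \<notin> R"
begin

lemma rel_scal:
  assumes "(a, b) \<in> R" "r \<in> {0..1}"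
  shows "(r \<cdot> a, r \<cdot> b) \<in> R"
proof -
  have ab: "a \<in> carrier E" "b \<in> carrier E" using rel_closed assms by auto
  have "((r \<cdot> \<one>\<^sub>E) \<odot> a, (r \<cdot> \<one>\<^sub>E) \<odot> b) \<in> R"
    using rel_sprod assms scal_closed one_closed by blast
  then show ?thesis using scal_sprod[of "\<one>\<^sub>E" _ r] ab assms one_closed one_sprod by simp
qed

text \<open>Adding two inequalities outright may leave the domain of the sum; weights with r + s
  \<le> 1 never do. This is the form in which inequalities of R are added from here on.\<close>

lemma rel_mix:
  assumes "(a, b) \<in> R" "(c, d) \<in> R" "r \<in> {0..1}" "s \<in> {0..1}" "r + s \<le> 1"
  shows "(r \<cdot> a \<boxplus> s \<cdot> c, r \<cdot> b \<boxplus> s \<cdot> d) \<in> R"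
proof -
  have c: "a \<in> carrier E" "b \<in> carrier E" "c \<in> carrier E" "d \<in> carrier E"
    using rel_closed assms by auto
  have sc: "r \<cdot> a \<in> carrier E" "r \<cdot> b \<in> carrier E" "s \<cdot> c \<in> carrier E" "s \<cdot> d \<in> carrier E"
    using scal_closed c assms by auto
  have o: "r \<cdot> a \<perp> s \<cdot> c" "r \<cdot> b \<perp> s \<cdot> c" "r \<cdot> b \<perp> s \<cdot> d" "s \<cdot> c \<perp> r \<cdot> b" "s \<cdot> d \<perp> r \<cdot> b"
    using scal_orth c assms by (auto simp: add.commute)
  have 1: "(r \<cdot> a \<boxplus> s \<cdot> c, r \<cdot> b \<boxplus> s \<cdot> c) \<in> R"
    using rel_esum_right[of "r \<cdot> a" "s \<cdot> c" "r \<cdot> b"] rel_scal assms sc o by blast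
  have "(s \<cdot> c \<boxplus> r \<cdot> b, s \<cdot> d \<boxplus> r \<cdot> b) \<in> R"
    using rel_esum_right[of "s \<cdot> c" "r \<cdot> b" "s \<cdot> d"] rel_scal assms sc o by blast
  then have "(r \<cdot> b \<boxplus> s \<cdot> c, r \<cdot> b \<boxplus> s \<cdot> d) \<in> R"
    using esum_commute[of "s \<cdot> c" "r \<cdot> b"] esum_commute[of "s \<cdot> d" "r \<cdot> b"] o sc by simp
  with 1 show ?thesis using rel_trans by blast
qed

lemma scal_rel_zero:
  assumes "(t \<cdot> \<one>\<^sub>E, \<zero>\<^sub>E) \<in> R" "0 < t" "t \<le> 1"
  shows False
  using rel_scal_cancel[of t "\<one>\<^sub>E" "\<zero>\<^sub>E"] rel_proper assms scal_zero_right[of t]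
    one_closed zero_closed by simp

text \<open>Otherwise cancelling s would place the positive scalar r - s below 0, and rescaling
  would place 1 there.\<close>

lemma scal_one_rel:
  assumes "(r \<cdot> \<one>\<^sub>E, s \<cdot> \<one>\<^sub>E) \<in> R" "r \<in> {0..1}" "s \<in> {0..1}"
  shows "r \<le> s"
proof (rule ccontr)
  assume "\<not> r \<le> s"
  then have t: "r - s \<in> {0..1}" "0 < r - s" using assms by auto
  have "((r - s) \<cdot> \<one>\<^sub>E \<boxplus> s \<cdot> \<one>\<^sub>E, \<zero>\<^sub>E \<boxplus> s \<cdot> \<one>\<^sub>E) \<in> R"
    using assms scal_add[of "r - s" s "\<one>\<^sub>E"] t one_closed zero_esum scal_closed by simp
  then have "((r - s) \<cdot> \<one>\<^sub>E, \<zero>\<^sub>E) \<in> R"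
    using rel_esum_right[of "(r - s) \<cdot> \<one>\<^sub>E" "s \<cdot> \<one>\<^sub>E" "\<zero>\<^sub>E"] scal_orth[of "r - s" s "\<one>\<^sub>E" "\<one>\<^sub>E"]
      t assms zero_orth zero_closed one_closed scal_closed by simp
  then show False using scal_rel_zero[of "r - s"] t by simp
qed

section \<open>Lower bounds by scalars, and adjoining an upper bound\<close>

definition lower :: "'a \<Rightarrow> real"
  where "lower c = Sup {r. r \<in> {0..1} \<and> (r \<cdot> \<one>\<^sub>E, c) \<in> R}"

lemma
  assumes "c \<in> carrier E"
  shows lower_upper: "\<And>r. \<lbrakk>r \<in> {0..1}; (r \<cdot> \<one>\<^sub>E, c) \<in> R\<rbrakk> \<Longrightarrow> r \<le> lower c"
    and lower_bounds: "lower c \<in> {0..1}"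
    and lower_approx: "\<And>e. 0 < e \<Longrightarrow> \<exists>r\<in>{0..1}. (r \<cdot> \<one>\<^sub>E, c) \<in> R \<and> lower c - e < r \<and> r \<le> lower c"
proof -
  let ?S = "{r. r \<in> {0..1} \<and> (r \<cdot> \<one>\<^sub>E, c) \<in> R}"
  have b: "bdd_above ?S" by (rule bdd_aboveI[of _ 1]) auto
  have 0: "0 \<in> ?S" using le_rel zero_le assms scal_zero one_closed zero_closed by simp
  show u: "r \<le> lower c" if "r \<in> {0..1}" "(r \<cdot> \<one>\<^sub>E, c) \<in> R" for r
    unfolding lower_def using cSup_upper[OF _ b] that by blast
  have "?S \<noteq> {}" using 0 by blast
  then have "lower c \<le> 1" unfolding lower_def by (rule cSup_least) simp
  then show "lower c \<in> {0..1}" using u 0 by auto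
  show "\<exists>r\<in>{0..1}. (r \<cdot> \<one>\<^sub>E, c) \<in> R \<and> lower c - e < r \<and> r \<le> lower c" if "0 < e" for e
  proof -
    have "lower c - e < Sup ?S" using that unfolding lower_def by simp
    then obtain r where "r \<in> ?S" "lower c - e < r" using less_cSupD[of ?S] 0 by blast
    then show ?thesis using u by blast
  qed
qed

text \<open>With s = \<open>lower c\<close>, the condition reads \<alpha> (b - a) - p (s - c) / 2
  \<ge> 0: up to a positive factor, b - a lies in the cone enlarged by all multiples p (s - c). The
  factor 1/2 and the bound \<alpha> \<le> 1/2 keep both sums defined.\<close>

definition adjoin :: "'a \<Rightarrow> ('a \<times> 'a) set"
  where "adjoin c = {(a, b). a \<in> carrier E \<and> b \<in> carrier E \<and> (\<exists>\<alpha> p. 0 < \<alpha> \<and> \<alpha> \<le> 1/2 \<and> p \<in> carrier E \<and>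
    (\<alpha> \<cdot> a \<boxplus> (1/2) \<cdot> lower c \<cdot> p, \<alpha> \<cdot> b \<boxplus> (1/2) \<cdot> (p \<odot> c)) \<in> R)}"

lemma adjoinI:
  "\<lbrakk>(\<alpha> \<cdot> a \<boxplus> (1/2) \<cdot> lower c \<cdot> p, \<alpha> \<cdot> b \<boxplus> (1/2) \<cdot> (p \<odot> c)) \<in> R; 0 < \<alpha>; \<alpha> \<le> 1/2;
    a \<in> carrier E; b \<in> carrier E; p \<in> carrier E\<rbrakk> \<Longrightarrow> (a, b) \<in> adjoin c"
  unfolding adjoin_def by blast

lemma adjoinE:
  assumes "(a, b) \<in> adjoin c"
  obtains \<alpha> p where "a \<in> carrier E" "b \<in> carrier E" "p \<in> carrier E" "0 < \<alpha>" "\<alpha> \<le> 1/2"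
    "(\<alpha> \<cdot> a \<boxplus> (1/2) \<cdot> lower c \<cdot> p, \<alpha> \<cdot> b \<boxplus> (1/2) \<cdot> (p \<odot> c)) \<in> R"
  using assms unfolding adjoin_def by blast

lemma rel_subset_adjoin:
  assumes "c \<in> carrier E"
  shows "R \<subseteq> adjoin c"
proof (rule subrelI)
  fix a b assume ab: "(a, b) \<in> R"
  then have c: "a \<in> carrier E" "b \<in> carrier E" using rel_closed by auto
  have "(1/2) \<cdot> lower c \<cdot> \<zero>\<^sub>E = \<zero>\<^sub>E" "(1/2) \<cdot> (\<zero>\<^sub>E \<odot> c) = \<zero>\<^sub>E"
    using scal_zero_right[of "1/2"] scal_zero_right[OF lower_bounds] sprod_zero
      sprod_commute[of "\<zero>\<^sub>E" c] zero_closed assms by auto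
  moreover have "((1/2) \<cdot> a, (1/2) \<cdot> b) \<in> R" using rel_scal ab by simp
  ultimately show "(a, b) \<in> adjoin c"
    using c zero_closed esum_zero scal_closed by (intro adjoinI[of "1/2" a c "\<zero>\<^sub>E" b]) auto
qed

text \<open>With p = 1 and \<alpha> = 1/2 the two sides of the defining inequality are one sum,
  written in its two orders.\<close>

lemma adjoin_lower:
  assumes "c \<in> carrier E"
  shows "(c, lower c \<cdot> \<one>\<^sub>E) \<in> adjoin c"
proof (rule adjoinI[of "1/2" c c "\<one>\<^sub>E"])
  have l: "lower c \<cdot> \<one>\<^sub>E \<in> carrier E" using lower_bounds assms scal_closed one_closed by blast
  have "(1/2) \<cdot> c \<boxplus> (1/2) \<cdot> lower c \<cdot> \<one>\<^sub>E = (1/2) \<cdot> lower c \<cdot> \<one>\<^sub>E \<boxplus> (1/2) \<cdot> (\<one>\<^sub>E \<odot> c)"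
    using esum_commute[OF scal_orth] l assms one_sprod scal_closed by simp
  then show "((1/2) \<cdot> c \<boxplus> (1/2) \<cdot> lower c \<cdot> \<one>\<^sub>E, (1/2) \<cdot> lower c \<cdot> \<one>\<^sub>E \<boxplus> (1/2) \<cdot> (\<one>\<^sub>E \<odot> c)) \<in> R"
    using le_rel eff_le_refl mix_closed[of "1/2" "1/2" c "lower c \<cdot> \<one>\<^sub>E"] l assms by simp
qed (use lower_bounds[OF assms] scal_closed one_closed assms in auto)

text \<open>Weighting the two witnessing inequalities by \<beta>/2 and \<alpha>/2 gives b the same
  coefficient \<gamma> = \<alpha>\<beta>/2 on the right of the first and on the left of the second,
  so it cancels in their sum. The multipliers combine to x = (\<beta>/2) p + (\<alpha>/2) q.\<close>

lemma adjoin_trans: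
  assumes c: "c \<in> carrier E" and ab: "(a, b) \<in> adjoin c" and bd: "(b, d) \<in> adjoin c"
  shows "(a, d) \<in> adjoin c"
proof -
  define s where "s = lower c"
  have s: "s \<in> {0..1}" unfolding s_def using lower_bounds c .
  obtain \<alpha> p where 1: "a \<in> carrier E" "b \<in> carrier E" "p \<in> carrier E" "0 < \<alpha>" "\<alpha> \<le> 1/2"
    "(\<alpha> \<cdot> a \<boxplus> (1/2) \<cdot> s \<cdot> p, \<alpha> \<cdot> b \<boxplus> (1/2) \<cdot> (p \<odot> c)) \<in> R"
    using ab unfolding s_def by (rule adjoinE)
  obtain \<beta> q where 2: "d \<in> carrier E" "q \<in> carrier E" "0 < \<beta>" "\<beta> \<le> 1/2"
    "(\<beta> \<cdot> b \<boxplus> (1/2) \<cdot> s \<cdot> q, \<beta> \<cdot> d \<boxplus> (1/2) \<cdot> (q \<odot> c)) \<in> R"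
    using bd unfolding s_def by (rule adjoinE)
  define \<gamma> where "\<gamma> = \<alpha> * \<beta> / 2"
  have "\<alpha> * \<beta> \<le> 1 * 1" using 1 2 by (intro mult_mono) auto
  then have g: "0 < \<gamma>" "\<gamma> \<le> 1/2" unfolding \<gamma>_def using 1 2 by auto
  have "\<alpha> * \<beta> \<le> (1/2) * (1/2)" using 1 2 by (intro mult_mono) auto
  then have g4: "\<gamma> \<le> 1/8" unfolding \<gamma>_def by simp
  define x where "x = (\<beta>/2) \<cdot> p \<boxplus> (\<alpha>/2) \<cdot> q"
  have x: "x \<in> carrier E" unfolding x_def using 1 2 by (intro mix_closed) auto
  have sp: "s \<cdot> p \<in> carrier E" "s \<cdot> q \<in> carrier E" "p \<odot> c \<in> carrier E" "q \<odot> c \<in> carrier E"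
    using scal_closed sprod_closed s c 1 2 by auto
  have gc: "\<gamma> \<cdot> a \<in> carrier E" "\<gamma> \<cdot> b \<in> carrier E" "\<gamma> \<cdot> d \<in> carrier E"
    using scal_closed g 1 2 by auto
  \<comment> \<open>Distributes the weights over one side of both inequalities and sorts the four
    summands into \<gamma>-terms and multiplier terms.\<close>
  have m: "(\<beta>/2) \<cdot> (\<alpha> \<cdot> u \<boxplus> (1/2) \<cdot> y) \<boxplus> (\<alpha>/2) \<cdot> (\<beta> \<cdot> v \<boxplus> (1/2) \<cdot> z)
      = (\<gamma> \<cdot> u \<boxplus> \<gamma> \<cdot> v) \<boxplus> ((\<beta>/4) \<cdot> y \<boxplus> (\<alpha>/4) \<cdot> z)
      \<and> (\<gamma> \<cdot> u \<boxplus> \<gamma> \<cdot> v) \<perp> ((\<beta>/4) \<cdot> y \<boxplus> (\<alpha>/4) \<cdot> z)"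
    if "u \<in> carrier E" "v \<in> carrier E" "y \<in> carrier E" "z \<in> carrier E" for u v y z
  proof -
    have e: "(\<beta>/2) \<cdot> (\<alpha> \<cdot> u \<boxplus> (1/2) \<cdot> y) = \<gamma> \<cdot> u \<boxplus> (\<beta>/4) \<cdot> y"
      "(\<alpha>/2) \<cdot> (\<beta> \<cdot> v \<boxplus> (1/2) \<cdot> z) = \<gamma> \<cdot> v \<boxplus> (\<alpha>/4) \<cdot> z"
      using scal_mix[of "\<beta>/2" \<alpha> "1/2" u y] scal_mix[of "\<alpha>/2" \<beta> "1/2" v z] 1 2 that
      by (simp_all add: \<gamma>_def mult.commute)
    have o: "(\<beta>/2) \<cdot> (\<alpha> \<cdot> u \<boxplus> (1/2) \<cdot> y) \<perp> (\<alpha>/2) \<cdot> (\<beta> \<cdot> v \<boxplus> (1/2) \<cdot> z)"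
      using 1 2 that by (intro scal_orth mix_closed) auto
    show ?thesis
      using esum_swap[of "\<gamma> \<cdot> u" "(\<beta>/4) \<cdot> y" "\<gamma> \<cdot> v" "(\<alpha>/4) \<cdot> z"] o that scal_closed
        scal_orth[of \<gamma> "\<beta>/4" u y] scal_orth[of \<gamma> "\<alpha>/4" v z] g g4 1 2
      unfolding e by simp
  qed
  have L: "(\<beta>/4) \<cdot> s \<cdot> p \<boxplus> (\<alpha>/4) \<cdot> s \<cdot> q = (1/2) \<cdot> s \<cdot> x"
  proof -
    have "s * \<beta> \<le> 1 * 1" "s * \<alpha> \<le> 1 * 1" using s 1 2 by (intro mult_mono; simp)+
    moreover have "0 \<le> s * \<beta>" "0 \<le> s * \<alpha>" using s 1 2 by auto
    ultimately have "(1/2) \<cdot> s \<cdot> x = (1/2 * (s * (\<beta>/2))) \<cdot> p \<boxplus> (1/2 * (s * (\<alpha>/2))) \<cdot> q"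
      using scal_mix[of s "\<beta>/2" "\<alpha>/2" p q] scal_mix[of "1/2" "s * (\<beta>/2)" "s * (\<alpha>/2)" p q] s 1 2
      unfolding x_def by simp
    then show ?thesis
      using scal_mult[of "\<beta>/4" s p] scal_mult[of "\<alpha>/4" s q] s 1 2
      by (simp add: mult.commute)
  qed
  have Rr: "(\<beta>/4) \<cdot> (p \<odot> c) \<boxplus> (\<alpha>/4) \<cdot> (q \<odot> c) = (1/2) \<cdot> (x \<odot> c)"
    using sprod_mix[of c "\<beta>/2" "\<alpha>/2" p q] scal_mix[of "1/2" "\<beta>/2" "\<alpha>/2" "p \<odot> c" "q \<odot> c"]
      sprod_commute[of x c] sprod_commute[of p c] sprod_commute[of q c] x sp c 1 2
    unfolding x_def by simp
  have r: "((\<gamma> \<cdot> a \<boxplus> \<gamma> \<cdot> b) \<boxplus> (1/2) \<cdot> s \<cdot> x, (\<gamma> \<cdot> b \<boxplus> \<gamma> \<cdot> d) \<boxplus> (1/2) \<cdot> (x \<odot> c)) \<in> R"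
    using rel_mix[OF 1(6) 2(5), of "\<beta>/2" "\<alpha>/2"] m[of a b "s \<cdot> p" "s \<cdot> q"]
      m[of b d "p \<odot> c" "q \<odot> c"] sp 1 2 unfolding L Rr by simp
  have xs: "(1/2) \<cdot> s \<cdot> x \<in> carrier E" "(1/2) \<cdot> (x \<odot> c) \<in> carrier E"
    using scal_closed sprod_closed s x c by auto
  have l: "(\<gamma> \<cdot> a \<boxplus> \<gamma> \<cdot> b) \<boxplus> (1/2) \<cdot> s \<cdot> x = (\<gamma> \<cdot> a \<boxplus> (1/2) \<cdot> s \<cdot> x) \<boxplus> \<gamma> \<cdot> b
      \<and> (\<gamma> \<cdot> a \<boxplus> (1/2) \<cdot> s \<cdot> x) \<perp> \<gamma> \<cdot> b"
    using esum_swap_right[of "\<gamma> \<cdot> a" "\<gamma> \<cdot> b" "(1/2) \<cdot> s \<cdot> x"] gc xs m[of a b "s \<cdot> p" "s \<cdot> q"] sp 1 2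
      scal_orth[of \<gamma> \<gamma> a b] g unfolding L by simp
  have "\<gamma> \<cdot> b \<boxplus> \<gamma> \<cdot> d = \<gamma> \<cdot> d \<boxplus> \<gamma> \<cdot> b"
    using esum_commute scal_orth[of \<gamma> \<gamma> b d] g gc 1 2 by simp
  then have rr: "(\<gamma> \<cdot> b \<boxplus> \<gamma> \<cdot> d) \<boxplus> (1/2) \<cdot> (x \<odot> c) = (\<gamma> \<cdot> d \<boxplus> (1/2) \<cdot> (x \<odot> c)) \<boxplus> \<gamma> \<cdot> b
      \<and> (\<gamma> \<cdot> d \<boxplus> (1/2) \<cdot> (x \<odot> c)) \<perp> \<gamma> \<cdot> b"
    using esum_swap_right[of "\<gamma> \<cdot> d" "\<gamma> \<cdot> b" "(1/2) \<cdot> (x \<odot> c)"] gc xs m[of b d "p \<odot> c" "q \<odot> c"] sp 1 2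
      scal_orth[of \<gamma> \<gamma> d b] g unfolding Rr by simp
  have "\<gamma> \<cdot> a \<boxplus> (1/2) \<cdot> s \<cdot> x \<in> carrier E" "\<gamma> \<cdot> d \<boxplus> (1/2) \<cdot> (x \<odot> c) \<in> carrier E"
    using g 1 2 s x c scal_closed sprod_closed by (auto intro!: mix_closed)
  \<comment> \<open>The common summand \<gamma> b now stands last on both sides and is
    cancelled.\<close>
  then have "(\<gamma> \<cdot> a \<boxplus> (1/2) \<cdot> s \<cdot> x, \<gamma> \<cdot> d \<boxplus> (1/2) \<cdot> (x \<odot> c)) \<in> R"
    using rel_esum_right[of "\<gamma> \<cdot> a \<boxplus> (1/2) \<cdot> s \<cdot> x" "\<gamma> \<cdot> b" "\<gamma> \<cdot> d \<boxplus> (1/2) \<cdot> (x \<odot> c)"] r l rr gc by simp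
  then show ?thesis using adjoinI[of \<gamma> a c x d] g 1 2 x unfolding s_def by blast
qed

text \<open>Scaling by \<alpha> splits \<alpha> e off both sides, where R cancels it; the same
  \<alpha> and p therefore witness both directions.\<close>

lemma adjoin_esum_right:
  assumes c: "c \<in> carrier E" and o: "a \<perp> e" "b \<perp> e"
    and abe: "a \<in> carrier E" "b \<in> carrier E" "e \<in> carrier E"
  shows "(a \<boxplus> e, b \<boxplus> e) \<in> adjoin c \<longleftrightarrow> (a, b) \<in> adjoin c"
proof -
  have m: "\<alpha> \<cdot> (u \<boxplus> e) \<boxplus> (1/2) \<cdot> y = (\<alpha> \<cdot> u \<boxplus> (1/2) \<cdot> y) \<boxplus> \<alpha> \<cdot> e
      \<and> (\<alpha> \<cdot> u \<boxplus> (1/2) \<cdot> y) \<perp> \<alpha> \<cdot> e \<and> \<alpha> \<cdot> u \<boxplus> (1/2) \<cdot> y \<in> carrier E"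
    if "u \<in> carrier E" "u \<perp> e" "y \<in> carrier E" "0 < \<alpha>" "\<alpha> \<le> 1/2" for u y \<alpha>
    using esum_swap_right[of "\<alpha> \<cdot> u" "\<alpha> \<cdot> e" "(1/2) \<cdot> y"] scal_esum[of \<alpha> u e]
      scal_orth[of \<alpha> "1/2" "u \<boxplus> e" y] mix_closed[of \<alpha> "1/2" u y] scal_closed esum_closed that abe
    by simp
  have *: "(\<alpha> \<cdot> (a \<boxplus> e) \<boxplus> (1/2) \<cdot> lower c \<cdot> p, \<alpha> \<cdot> (b \<boxplus> e) \<boxplus> (1/2) \<cdot> (p \<odot> c)) \<in> R \<longleftrightarrow>
      (\<alpha> \<cdot> a \<boxplus> (1/2) \<cdot> lower c \<cdot> p, \<alpha> \<cdot> b \<boxplus> (1/2) \<cdot> (p \<odot> c)) \<in> R"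
    if "0 < \<alpha>" "\<alpha> \<le> 1/2" "p \<in> carrier E" for \<alpha> p
    using m[of a "lower c \<cdot> p" \<alpha>] m[of b "p \<odot> c" \<alpha>] that abe o c lower_bounds[OF c]
      scal_closed sprod_closed rel_esum_right by simp
  have "a \<boxplus> e \<in> carrier E" "b \<boxplus> e \<in> carrier E" using esum_closed o abe by auto
  then show ?thesis unfolding adjoin_def using * abe by blast
qed

text \<open>The multiplier p of the given witness becomes q p, by associativity and homogeneity of
  the product.\<close>

lemma adjoin_sprod:
  assumes c: "c \<in> carrier E" and ab: "(a, b) \<in> adjoin c" and q: "q \<in> carrier E"
  shows "(q \<odot> a, q \<odot> b) \<in> adjoin c"
proof -
  obtain \<alpha> p where 1: "a \<in> carrier E" "b \<in> carrier E" "p \<in> carrier E" "0 < \<alpha>" "\<alpha> \<le> 1/2"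
    "(\<alpha> \<cdot> a \<boxplus> (1/2) \<cdot> lower c \<cdot> p, \<alpha> \<cdot> b \<boxplus> (1/2) \<cdot> (p \<odot> c)) \<in> R"
    using ab by (rule adjoinE)
  have "(q \<odot> (\<alpha> \<cdot> a \<boxplus> (1/2) \<cdot> lower c \<cdot> p), q \<odot> (\<alpha> \<cdot> b \<boxplus> (1/2) \<cdot> (p \<odot> c))) \<in> R"
    using rel_sprod 1 q by blast
  moreover have "q \<odot> (\<alpha> \<cdot> a \<boxplus> (1/2) \<cdot> lower c \<cdot> p) = \<alpha> \<cdot> (q \<odot> a) \<boxplus> (1/2) \<cdot> lower c \<cdot> (q \<odot> p)"
    using sprod_mix[of q \<alpha> "1/2" a "lower c \<cdot> p"] sprod_scal[OF q _ lower_bounds[OF c]]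
      scal_closed[OF lower_bounds[OF c]] 1 q by simp
  moreover have "q \<odot> (\<alpha> \<cdot> b \<boxplus> (1/2) \<cdot> (p \<odot> c)) = \<alpha> \<cdot> (q \<odot> b) \<boxplus> (1/2) \<cdot> ((q \<odot> p) \<odot> c)"
    using sprod_mix[of q \<alpha> "1/2" b "p \<odot> c"] sprod_assoc[of q p c] sprod_closed 1 q c by simp
  ultimately show ?thesis
    using 1 q sprod_closed by (intro adjoinI[of \<alpha> "q \<odot> a" c "q \<odot> p" "q \<odot> b"]) auto
qed

lemma adjoin_scal_cancel:
  assumes "(r \<cdot> a, r \<cdot> b) \<in> adjoin c" "0 < r" "r \<le> 1" "a \<in> carrier E" "b \<in> carrier E"
  shows "(a, b) \<in> adjoin c"
proof -
  obtain \<alpha> p where 1: "p \<in> carrier E" "0 < \<alpha>" "\<alpha> \<le> 1/2"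
    "(\<alpha> \<cdot> r \<cdot> a \<boxplus> (1/2) \<cdot> lower c \<cdot> p, \<alpha> \<cdot> r \<cdot> b \<boxplus> (1/2) \<cdot> (p \<odot> c)) \<in> R"
    using assms(1) by (rule adjoinE)
  moreover have "\<alpha> * r \<le> 1/2" using mult_mono[of \<alpha> "1/2" r 1] assms 1 by simp
  ultimately show ?thesis
    using adjoinI[of "\<alpha> * r" a c p b] scal_mult[of \<alpha> r] assms by simp
qed

text \<open>Multiplying \<open>lower c \<le> c\<close> by the complement of \<open>p\<close> and adding it to
  \<open>\<alpha> + lower c p \<le> p c\<close> would raise the lower bound of \<open>c\<close> by \<open>\<alpha>\<close>.\<close>

lemma adjoin_proper:
  assumes c: "c \<in> carrier E"
  shows "(\<one>\<^sub>E, \<zero>\<^sub>E) \<notin> adjoin c"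
proof
  assume "(\<one>\<^sub>E, \<zero>\<^sub>E) \<in> adjoin c"
  then obtain \<alpha> p where 1: "p \<in> carrier E" "0 < \<alpha>" "\<alpha> \<le> 1/2"
    "(\<alpha> \<cdot> \<one>\<^sub>E \<boxplus> (1/2) \<cdot> lower c \<cdot> p, \<alpha> \<cdot> \<zero>\<^sub>E \<boxplus> (1/2) \<cdot> (p \<odot> c)) \<in> R"
    by (rule adjoinE)
  define q where "q = ecompl E p"
  have q: "q \<in> carrier E" "p \<perp> q" "p \<boxplus> q = \<one>\<^sub>E" unfolding q_def using ecompl 1 by auto
  \<comment> \<open>As \<open>lower c\<close> is only a supremum, a scalar s close to it is taken.
    Closeness \<alpha> is enough, since the argument gains 2\<alpha>.\<close>
  obtain s where s: "s \<in> {0..1}" "(s \<cdot> \<one>\<^sub>E, c) \<in> R" "lower c - \<alpha> < s" "s \<le> lower c"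
    using lower_approx[OF c 1(2)] by blast
  have sq: "s \<cdot> q \<in> carrier E" "s \<cdot> p \<in> carrier E" "lower c \<cdot> p \<in> carrier E"
      "p \<odot> c \<in> carrier E" "q \<odot> c \<in> carrier E"
    using s lower_bounds[OF c] scal_closed sprod_closed q 1 c by auto
  have "(q \<odot> (s \<cdot> \<one>\<^sub>E), q \<odot> c) \<in> R" using rel_sprod s q by blast
  then have "(s \<cdot> q, q \<odot> c) \<in> R" using sprod_scal[of q "\<one>\<^sub>E" s] sprod_one q s one_closed by simp
  then have "((1/2) \<cdot> s \<cdot> q, (1/2) \<cdot> (q \<odot> c)) \<in> R" using rel_scal by simp
  \<comment> \<open>On the right p c / 4 and q c / 4 add up to c / 4, as p and q are complementary.
    On the left, replacing \<open>lower c\<close> by the smaller s lets s p and s q combine to s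
    1.\<close>
  then have "((1/2) \<cdot> (\<alpha> \<cdot> \<one>\<^sub>E \<boxplus> (1/2) \<cdot> lower c \<cdot> p) \<boxplus> (1/2) \<cdot> (1/2) \<cdot> s \<cdot> q,
      (1/2) \<cdot> (\<alpha> \<cdot> \<zero>\<^sub>E \<boxplus> (1/2) \<cdot> (p \<odot> c)) \<boxplus> (1/2) \<cdot> (1/2) \<cdot> (q \<odot> c)) \<in> R"
    by (rule rel_mix[OF 1(4)]) simp_all
  moreover have "(1/2) \<cdot> (\<alpha> \<cdot> \<zero>\<^sub>E \<boxplus> (1/2) \<cdot> (p \<odot> c)) \<boxplus> (1/2) \<cdot> (1/2) \<cdot> (q \<odot> c) = (1/4) \<cdot> c"
  proof -
    have pq: "p \<odot> c \<perp> q \<odot> c" "p \<odot> c \<boxplus> q \<odot> c = c"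
      using sprod_esum_left[of c p q] q 1 c one_sprod by auto
    have "(1/2) \<cdot> (\<alpha> \<cdot> \<zero>\<^sub>E \<boxplus> (1/2) \<cdot> (p \<odot> c)) = (1/4) \<cdot> (p \<odot> c)"
      "(1/2) \<cdot> (1/2) \<cdot> (q \<odot> c) = (1/4) \<cdot> (q \<odot> c)"
      using scal_zero_right[of \<alpha>] zero_esum scal_mult[of "1/2" "1/2"] sq scal_closed 1 by simp_all
    then show ?thesis using scal_esum[of "1/4" "p \<odot> c" "q \<odot> c"] pq sq by simp
  qed
  moreover have "(\<alpha>/2 + s/4) \<cdot> \<one>\<^sub>E
      \<preceq> (1/2) \<cdot> (\<alpha> \<cdot> \<one>\<^sub>E \<boxplus> (1/2) \<cdot> lower c \<cdot> p) \<boxplus> (1/2) \<cdot> (1/2) \<cdot> s \<cdot> q"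
  proof -
    have pq: "s \<cdot> p \<perp> s \<cdot> q" "s \<cdot> p \<boxplus> s \<cdot> q = s \<cdot> \<one>\<^sub>E"
      using scal_esum[of s p q] q 1 s by auto
    have o: "(1/4) \<cdot> s \<cdot> p \<perp> (1/4) \<cdot> s \<cdot> q" "(1/4) \<cdot> s \<cdot> p \<boxplus> (1/4) \<cdot> s \<cdot> q = (s/4) \<cdot> \<one>\<^sub>E"
      using scal_esum[of "1/4" "s \<cdot> p" "s \<cdot> q"] scal_mult[of "1/4" s "\<one>\<^sub>E"] pq sq s one_closed by simp_all
    have cl: "(\<alpha>/2) \<cdot> \<one>\<^sub>E \<in> carrier E" "(1/4) \<cdot> s \<cdot> p \<in> carrier E" "(1/4) \<cdot> s \<cdot> q \<in> carrier E"
      using scal_closed one_closed sq 1 by auto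
    have "(\<alpha>/2 + s/4) \<cdot> \<one>\<^sub>E = (\<alpha>/2) \<cdot> \<one>\<^sub>E \<boxplus> ((1/4) \<cdot> s \<cdot> p \<boxplus> (1/4) \<cdot> s \<cdot> q)"
      "(\<alpha>/2) \<cdot> \<one>\<^sub>E \<perp> ((1/4) \<cdot> s \<cdot> p \<boxplus> (1/4) \<cdot> s \<cdot> q)"
      using scal_add[of "\<alpha>/2" "s/4" "\<one>\<^sub>E"] s 1 one_closed unfolding o by simp_all
    then have "(\<alpha>/2 + s/4) \<cdot> \<one>\<^sub>E = ((\<alpha>/2) \<cdot> \<one>\<^sub>E \<boxplus> (1/4) \<cdot> s \<cdot> p) \<boxplus> (1/4) \<cdot> s \<cdot> q"
      using esum_assoc[of "(\<alpha>/2) \<cdot> \<one>\<^sub>E" "(1/4) \<cdot> s \<cdot> p" "(1/4) \<cdot> s \<cdot> q"] cl o by simp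
    also have "\<dots> = (1/2) \<cdot> (\<alpha> \<cdot> \<one>\<^sub>E \<boxplus> (1/2) \<cdot> s \<cdot> p) \<boxplus> (1/2) \<cdot> (1/2) \<cdot> s \<cdot> q"
      using scal_mix[of "1/2" \<alpha> "1/2" "\<one>\<^sub>E" "s \<cdot> p"] scal_mult[of "1/2" "1/2" "s \<cdot> q"] 1 sq one_closed
      by simp
    also have "\<dots> \<preceq> (1/2) \<cdot> (\<alpha> \<cdot> \<one>\<^sub>E \<boxplus> (1/2) \<cdot> lower c \<cdot> p) \<boxplus> (1/2) \<cdot> (1/2) \<cdot> s \<cdot> q"
    proof -
      have "s \<cdot> p \<preceq> lower c \<cdot> p"
        using s lower_bounds[OF c] 1 by (intro scal_mono_left) auto
      then have "\<alpha> \<cdot> \<one>\<^sub>E \<boxplus> (1/2) \<cdot> s \<cdot> p \<preceq> \<alpha> \<cdot> \<one>\<^sub>E \<boxplus> (1/2) \<cdot> lower c \<cdot> p"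
        using 1 sq one_closed eff_le_refl scal_closed by (intro esum_mono scal_mono[of "s \<cdot> p"] scal_orth) auto
      then show ?thesis
        using 1 sq one_closed eff_le_refl scal_closed mix_closed
        by (intro mix_mono[of "\<alpha> \<cdot> \<one>\<^sub>E \<boxplus> (1/2) \<cdot> s \<cdot> p"]) auto
    qed
    finally show ?thesis .
  qed
  moreover have "(\<alpha>/2 + s/4) \<cdot> \<one>\<^sub>E \<in> carrier E" using scal_closed one_closed s 1 by auto
  ultimately have r: "((\<alpha>/2 + s/4) \<cdot> \<one>\<^sub>E, (1/4) \<cdot> c) \<in> R"
    using le_rel rel_closed rel_trans by (metis (no_types, lifting))
  show False
  \<comment> \<open>The inequality (\<alpha>/2 + s/4) 1 \<le> c/4 can be multiplied by 4 only if
    2\<alpha> + s is itself an admissible scalar. Otherwise it contradicts c \<le> 1.\<close>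
  proof (cases "2 * \<alpha> + s \<le> 1")
    case True
    then have "(1/4) \<cdot> (2 * \<alpha> + s) \<cdot> \<one>\<^sub>E = (\<alpha>/2 + s/4) \<cdot> \<one>\<^sub>E"
      using scal_mult[of "1/4" "2 * \<alpha> + s" "\<one>\<^sub>E"] s 1 one_closed by (simp add: field_simps)
    then have "((2 * \<alpha> + s) \<cdot> \<one>\<^sub>E, c) \<in> R"
      using rel_scal_cancel[of "1/4" "(2 * \<alpha> + s) \<cdot> \<one>\<^sub>E" c] r c scal_closed True s 1 one_closed by simp
    then have "2 * \<alpha> + s \<le> lower c" using lower_upper[OF c] True s 1 by simp
    then show False using s 1 by simp
  next
    case False
    have "((1/4) \<cdot> c, (1/4) \<cdot> \<one>\<^sub>E) \<in> R"
      using le_rel le_one rel_scal c one_closed by simp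
    then have "\<alpha>/2 + s/4 \<le> 1/4" 
      using scal_one_rel[of "\<alpha>/2 + s/4" "1/4"] rel_trans[OF r] s 1 by simp
    then show False using False by simp
  qed
qed

lemma module_preorder_adjoin:
  assumes "c \<in> carrier E"
  shows "module_preorder E scal (adjoin c)"
proof unfold_locales
  show "a \<in> carrier E \<and> b \<in> carrier E" if "(a, b) \<in> adjoin c" for a b
    using that unfolding adjoin_def by blast
  show "(a, b) \<in> adjoin c" if "a \<preceq> b" "a \<in> carrier E" "b \<in> carrier E" for a b
    using that le_rel rel_subset_adjoin assms by blast
qed (fact adjoin_trans[OF assms] adjoin_esum_right[OF assms] adjoin_sprod[OF assms]
    adjoin_scal_cancel adjoin_proper[OF assms])+

end

section \<open>Multiplicative states\<close>

context module_preorder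
begin

lemma lower_le:
  assumes "(c, r \<cdot> \<one>\<^sub>E) \<in> R" "r \<in> {0..1}"
  shows "lower c \<le> r"
proof (rule ccontr)
  assume "\<not> lower c \<le> r"
  moreover have "c \<in> carrier E" using rel_closed assms by blast
  ultimately obtain r' where "r' \<in> {0..1}" "(r' \<cdot> \<one>\<^sub>E, c) \<in> R" "lower c - (lower c - r) < r'"
    using lower_approx[of c "lower c - r"] by auto
  then show False using scal_one_rel[of r' r] rel_trans[of "r' \<cdot> \<one>\<^sub>E" c] assms by simp
qed

end

text \<open>Records what maximality yields rather than maximality itself. The opposite comparison,
  of a scalar with c from below, is available up to an arbitrarily small error through
  \<open>lower_approx\<close>; hence the error terms in the lower estimates that follow.\<close>

locale maximal_module_preorder = module_preorder +
  assumes rel_lower: "c \<in> carrier E \<Longrightarrow> (c, lower c \<cdot> \<one>\<^sub>E) \<in> R"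
begin

text \<open>Weighted sums come first because they are always defined; homogeneity is the case s = 0,
  and additivity is the case of two halves with the factor 1/2 cancelled. The upper estimate adds
  two instances of \<open>rel_lower\<close>; the lower one adds approximating scalars, whose
  weighted error is at most e because r + s \<le> 1.\<close>

lemma lower_mix:
  assumes rs: "r \<in> {0..1}" "s \<in> {0..1}" "r + s \<le> 1" and ab: "a \<in> carrier E" "b \<in> carrier E"
  shows "lower (r \<cdot> a \<boxplus> s \<cdot> b) = r * lower a + s * lower b"
proof (rule antisym)
  have mix: "r \<cdot> u \<cdot> \<one>\<^sub>E \<boxplus> s \<cdot> v \<cdot> \<one>\<^sub>E = (r * u + s * v) \<cdot> \<one>\<^sub>E \<and> r * u + s * v \<in> {0..1}"
    if "u \<in> {0..1}" "v \<in> {0..1}" for u v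
  proof -
    have "r * u \<le> r * 1" "s * v \<le> s * 1" using rs that by (intro mult_left_mono; simp)+
    then have "r * u \<in> {0..1}" "s * v \<in> {0..1}" "r * u + s * v \<in> {0..1}" using rs that by auto
    then show ?thesis using scal_add[of "r * u" "s * v" "\<one>\<^sub>E"] scal_mult rs that one_closed by simp
  qed
  have la: "lower a \<in> {0..1}" "lower b \<in> {0..1}" using lower_bounds ab by auto
  show "lower (r \<cdot> a \<boxplus> s \<cdot> b) \<le> r * lower a + s * lower b"
    using lower_le rel_mix[OF rel_lower[OF ab(1)] rel_lower[OF ab(2)] rs] mix[OF la] by simp
  show "r * lower a + s * lower b \<le> lower (r \<cdot> a \<boxplus> s \<cdot> b)"
  proof (rule field_le_epsilon)
    fix e :: real assume "0 < e"
    obtain u where u: "u \<in> {0..1}" "(u \<cdot> \<one>\<^sub>E, a) \<in> R" "lower a - e < u"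
      using lower_approx[OF ab(1) \<open>0 < e\<close>] by blast
    obtain v where v: "v \<in> {0..1}" "(v \<cdot> \<one>\<^sub>E, b) \<in> R" "lower b - e < v"
      using lower_approx[OF ab(2) \<open>0 < e\<close>] by blast
    have 1: "r * u + s * v \<le> lower (r \<cdot> a \<boxplus> s \<cdot> b)"
      using rel_mix[OF u(2) v(2) rs] mix[OF u(1) v(1)] mix_closed[OF rs ab]
      by (intro lower_upper) auto
    have "r * (lower a - e) \<le> r * u" "s * (lower b - e) \<le> s * v"
      using rs u v by (intro mult_left_mono; simp)+
    moreover have "(r + s) * e \<le> 1 * e" using rs \<open>0 < e\<close> by (intro mult_right_mono) auto
    ultimately show "r * lower a + s * lower b \<le> lower (r \<cdot> a \<boxplus> s \<cdot> b) + e"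
      using 1 by (simp add: algebra_simps)
  qed
qed

lemma lower_scal:
  assumes "r \<in> {0..1}" "a \<in> carrier E"
  shows "lower (r \<cdot> a) = r * lower a"
  using lower_mix[of r 0 a a] assms scal_zero esum_zero scal_closed by simp

lemma lower_esum:
  assumes "a \<perp> b" "a \<in> carrier E" "b \<in> carrier E"
  shows "lower (a \<boxplus> b) = lower a + lower b"
  using lower_mix[of "1/2" "1/2" a b] lower_scal[of "1/2" "a \<boxplus> b"] scal_esum[of "1/2" a b]
    esum_closed assms by simp

lemma lower_one: "lower \<one>\<^sub>E = 1"
  using lower_upper[of "\<one>\<^sub>E" 1] lower_bounds[of "\<one>\<^sub>E"] le_rel eff_le_refl scal_one one_closed
  by fastforce

text \<open>Multiplication by p turns a comparison of a with a scalar v into one of p a with v p,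
  and comparing p with a scalar finishes. Multiplicativity of the state thus comes from the
  stability of R under multiplication.\<close>

lemma lower_sprod:
  assumes p: "p \<in> carrier E" and a: "a \<in> carrier E"
  shows "lower (p \<odot> a) = lower p * lower a"
proof (rule antisym)
  have l: "lower p \<in> {0..1}" "lower a \<in> {0..1}" using lower_bounds p a by auto
  have ps: "p \<odot> (r \<cdot> \<one>\<^sub>E) = r \<cdot> p" if "r \<in> {0..1}" for r
    using sprod_scal[of p "\<one>\<^sub>E" r] that p one_closed sprod_one by simp
  have prod: "r * s \<in> {0..1}" if "r \<in> {0..1}" "s \<in> {0..1}" for r s :: real
    using that mult_mono[of r 1 s 1] by simp
  have "(p \<odot> a, lower a \<cdot> p) \<in> R"
    using rel_sprod[OF rel_lower[OF a] p] ps l by simp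
  moreover have "(lower a \<cdot> p, (lower a * lower p) \<cdot> \<one>\<^sub>E) \<in> R"
    using rel_scal[OF rel_lower[OF p] l(2)] scal_mult l one_closed by simp
  ultimately show "lower (p \<odot> a) \<le> lower p * lower a"
    using lower_le[of "p \<odot> a" "lower a * lower p"] rel_trans prod[OF l(2,1)]
    by (simp add: mult.commute)
  show "lower p * lower a \<le> lower (p \<odot> a)"
  proof (rule field_le_epsilon)
    fix e :: real assume "0 < e"
    then have e: "0 < e/2" by simp
    obtain u where u: "u \<in> {0..1}" "(u \<cdot> \<one>\<^sub>E, p) \<in> R" "lower p - e/2 < u"
      using lower_approx[OF p e] by blast
    obtain v where v: "v \<in> {0..1}" "(v \<cdot> \<one>\<^sub>E, a) \<in> R" "lower a - e/2 < v"
      using lower_approx[OF a e] by blast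
    have "(v \<cdot> p, p \<odot> a) \<in> R" using rel_sprod[OF v(2) p] ps v by simp
    moreover have "((v * u) \<cdot> \<one>\<^sub>E, v \<cdot> p) \<in> R"
      using rel_scal[OF u(2) v(1)] scal_mult u v one_closed by simp
    ultimately have 1: "v * u \<le> lower (p \<odot> a)"
      using lower_upper[of "p \<odot> a" "v * u"] rel_trans prod[OF v(1) u(1)] sprod_closed p a by blast
    \<comment> \<open>Both factors are at most 1, so an error of e/2 in each costs at most e in the
      product.\<close>
    have "lower a * lower p - v * u = lower a * (lower p - u) + u * (lower a - v)"
      by (simp add: algebra_simps)
    also have "\<dots> \<le> 1 * (e/2) + 1 * (e/2)"
    proof (rule add_mono)
      have "lower a * (lower p - u) \<le> lower a * (e/2)" using u l by (intro mult_left_mono) auto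
      also have "\<dots> \<le> 1 * (e/2)" using l e by (intro mult_right_mono) auto
      finally show "lower a * (lower p - u) \<le> 1 * (e/2)" .
      have "u * (lower a - v) \<le> u * (e/2)" using u v by (intro mult_left_mono) auto
      also have "\<dots> \<le> 1 * (e/2)" using u e by (intro mult_right_mono) auto
      finally show "u * (lower a - v) \<le> 1 * (e/2)" .
    qed
    finally show "lower p * lower a \<le> lower (p \<odot> a) + e" using 1 by (simp add: mult.commute)
  qed
qed

end

section \<open>Maximal preorders by Zorn's lemma, and separation by characters\<close>

context commutative_ses
begin

text \<open>Transitivity is the condition whose premises may come from two members, and a chain puts
  them into a common one. The order of E comes from any single member, so C must not be
  empty.\<close>

lemma module_preorder_Union:
  assumes ne: "C \<noteq> {}" and mp: "\<And>R. R \<in> C \<Longrightarrow> module_preorder E scal R"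
    and chain: "\<And>R R'. \<lbrakk>R \<in> C; R' \<in> C\<rbrakk> \<Longrightarrow> R \<subseteq> R' \<or> R' \<subseteq> R"
  shows "module_preorder E scal (\<Union>C)"
proof unfold_locales
  show "a \<in> carrier E \<and> b \<in> carrier E" if "(a, b) \<in> \<Union>C" for a b
    using that module_preorder.rel_closed[OF mp] by blast
  show "(a, b) \<in> \<Union>C" if "a \<preceq> b" "a \<in> carrier E" "b \<in> carrier E" for a b
    using that module_preorder.le_rel[OF mp] ne by blast
  show "(a, c) \<in> \<Union>C" if "(a, b) \<in> \<Union>C" "(b, c) \<in> \<Union>C" for a b c
  proof -
    obtain R R' where *: "R \<in> C" "R' \<in> C" "(a, b) \<in> R" "(b, c) \<in> R'" using \<open>(a, b) \<in> \<Union>C\<close> \<open>(b, c) \<in> \<Union>C\<close> by blast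
    then obtain S where "S \<in> C" "(a, b) \<in> S" "(b, c) \<in> S" using chain by blast
    then show ?thesis using module_preorder.rel_trans[OF mp] by blast
  qed
  show "(a \<boxplus> c, b \<boxplus> c) \<in> \<Union>C \<longleftrightarrow> (a, b) \<in> \<Union>C"
    if "a \<perp> c" "b \<perp> c" "a \<in> carrier E" "b \<in> carrier E" "c \<in> carrier E" for a b c
    using module_preorder.rel_esum_right[OF mp that] by blast
  show "(p \<odot> a, p \<odot> b) \<in> \<Union>C" if "(a, b) \<in> \<Union>C" "p \<in> carrier E" for a b p
    using that module_preorder.rel_sprod[OF mp] by blast
  show "(a, b) \<in> \<Union>C"
    if "(r \<cdot> a, r \<cdot> b) \<in> \<Union>C" "0 < r" "r \<le> 1" "a \<in> carrier E" "b \<in> carrier E" for r a b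
    using that(1) module_preorder.rel_scal_cancel[OF mp _ that(2-)] by blast
  show "(\<one>\<^sub>E, \<zero>\<^sub>E) \<notin> \<Union>C" using module_preorder.rel_proper[OF mp] by blast
qed

text \<open>For a Zorn-maximal M, the extension \<open>M.adjoin c\<close> is again a module preorder
  above R, so it equals M, and \<open>adjoin_lower\<close> then speaks of M itself.\<close>

lemma ex_maximal_module_preorder:
  assumes "module_preorder E scal R"
  shows "\<exists>M. R \<subseteq> M \<and> maximal_module_preorder E scal M"
proof -
  let ?A = "{M. module_preorder E scal M \<and> R \<subseteq> M}"
  have "\<exists>M\<in>?A. \<forall>X\<in>?A. M \<subseteq> X \<longrightarrow> X = M"
  proof (rule subset_Zorn_nonempty)
    show "?A \<noteq> {}" using assms by blast
    fix C assume "C \<noteq> {}" "subset.chain ?A C"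
    then show "\<Union>C \<in> ?A"
      using module_preorder_Union[of C] unfolding subset.chain_def by blast
  qed
  then obtain M where MA: "M \<in> ?A" and max: "\<forall>X\<in>?A. M \<subseteq> X \<longrightarrow> X = M" by (rule bexE)
  then have M: "module_preorder E scal M" "R \<subseteq> M" by simp_all
  interpret M: module_preorder E scal M by (rule M)
  have "(c, M.lower c \<cdot> \<one>\<^sub>E) \<in> M" if "c \<in> carrier E" for c
  proof -
    have "M.adjoin c = M"
      using max M.module_preorder_adjoin[OF that] M.rel_subset_adjoin[OF that] M by auto
    then show ?thesis using M.adjoin_lower[OF that] by simp
  qed
  then have "maximal_module_preorder E scal M" by unfold_locales
  then show ?thesis using M by blast
qed

text \<open>The multiplicative states. The value 0 off the carrier makes each of them determined by
  its values on E, while they remain plain elements of \<open>'a \<Rightarrow> real\<close> with its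
  product topology. If 0 = 1 in E there are none, and the representing space is empty.\<close>

definition characters :: "('a \<Rightarrow> real) set"
  where "characters = {\<phi>. (\<forall>a. a \<notin> carrier E \<longrightarrow> \<phi> a = 0) \<and> (\<forall>a\<in>carrier E. 0 \<le> \<phi> a) \<and> \<phi> \<one>\<^sub>E = 1 \<and>
    (\<forall>a\<in>carrier E. \<forall>b\<in>carrier E. a \<perp> b \<longrightarrow> \<phi> (a \<boxplus> b) = \<phi> a + \<phi> b) \<and>
    (\<forall>a\<in>carrier E. \<forall>b\<in>carrier E. \<phi> (a \<odot> b) = \<phi> a * \<phi> b) \<and>
    (\<forall>r\<in>{0..1}. \<forall>a\<in>carrier E. \<phi> (r \<cdot> a) = r * \<phi> a)}"

lemma characters_maximal:
  assumes "maximal_module_preorder E scal M"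
  shows "(\<lambda>a. if a \<in> carrier E then module_preorder.lower E scal M a else 0) \<in> characters"
proof -
  interpret M: maximal_module_preorder E scal M by (rule assms)
  show ?thesis
    unfolding characters_def
    using M.lower_bounds M.lower_one M.lower_esum M.lower_sprod M.lower_scal
      one_closed esum_closed sprod_closed scal_closed by auto
qed

lemma module_preorder_le:
  assumes "\<not> \<one>\<^sub>E \<preceq> \<zero>\<^sub>E"
  shows "module_preorder E scal {(a, b). a \<in> carrier E \<and> b \<in> carrier E \<and> a \<preceq> b}" (is "module_preorder E scal ?R")
proof unfold_locales
  show "a \<in> carrier E \<and> b \<in> carrier E" if "(a, b) \<in> ?R" for a b
    using that by simp
  show "(a, b) \<in> ?R" if "a \<preceq> b" "a \<in> carrier E" "b \<in> carrier E" for a b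
    using that by simp
  show "(a, c) \<in> ?R" if "(a, b) \<in> ?R" "(b, c) \<in> ?R" for a b c
    using that eff_le_trans[of a b c] by simp
  show "(a \<boxplus> c, b \<boxplus> c) \<in> ?R \<longleftrightarrow> (a, b) \<in> ?R"
    if "a \<perp> c" "b \<perp> c" "a \<in> carrier E" "b \<in> carrier E" "c \<in> carrier E" for a b c
    using esum_le_cancel[of a c b] esum_mono[of a b c c] eff_le_refl[of c] esum_closed that by auto
  show "(p \<odot> a, p \<odot> b) \<in> ?R" if "(a, b) \<in> ?R" "p \<in> carrier E" for a b p
    using that sprod_mono[of a b p] sprod_closed by simp
  show "(a, b) \<in> ?R"
    if "(r \<cdot> a, r \<cdot> b) \<in> ?R" "0 < r" "r \<le> 1" "a \<in> carrier E" "b \<in> carrier E" for r a b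
    using that scal_le_cancel[of r a b] by simp
  show "(\<one>\<^sub>E, \<zero>\<^sub>E) \<notin> ?R" using assms by simp
qed

text \<open>For c = (b + a') / 2, with a' the complement of a, a character satisfies \<phi> c < 1/2
  exactly when \<phi> b < \<phi> a. The Archimedean property gives \<open>R.lower c\<close> < 1/2
  for the given order, and adjoining c \<le> \<open>R.lower c\<close> before maximising hands this
  bound on to the character.\<close>

lemma characters_separate:
  assumes a: "a \<in> carrier E" and b: "b \<in> carrier E" and nle: "\<not> a \<preceq> b"
  shows "\<exists>\<phi>\<in>characters. \<phi> b < \<phi> a"
proof -
  define R where "R = {(a, b). a \<in> carrier E \<and> b \<in> carrier E \<and> a \<preceq> b}"
  \<comment> \<open>From 1 \<le> 0 would follow a \<le> 1 \<le> 0 \<le> b.\<close>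
  have "\<not> \<one>\<^sub>E \<preceq> \<zero>\<^sub>E"
    using nle eff_le_trans[of a "\<one>\<^sub>E" "\<zero>\<^sub>E"] eff_le_trans[of a "\<zero>\<^sub>E" b] le_one zero_le a b by blast
  then interpret R: module_preorder E scal R
    unfolding R_def by (rule module_preorder_le)
  define a' where "a' = ecompl E a"
  have a': "a' \<in> carrier E" "a \<perp> a'" "a \<boxplus> a' = \<one>\<^sub>E" unfolding a'_def using ecompl a by auto
  define c where "c = (1/2) \<cdot> b \<boxplus> (1/2) \<cdot> a'"
  have c: "c \<in> carrier E" unfolding c_def using mix_closed a' b by simp
  have s: "R.lower c < 1/2"
  proof (rule ccontr)
    assume ge: "\<not> R.lower c < 1/2"
    have "(1/2) \<cdot> a \<preceq> (1/2) \<cdot> b \<boxplus> ((1/2)^Suc n) \<cdot> \<one>\<^sub>E" for n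
    proof -
      define d :: real where "d = (1/2)^Suc n"
      have d: "0 < d" "d \<le> 1/2" unfolding d_def using power_le_one[of "1/2::real" n] by simp_all
      obtain r where r: "r \<in> {0..1}" "(r \<cdot> \<one>\<^sub>E, c) \<in> R" "R.lower c - d < r"
        using R.lower_approx[OF c d(1)] by blast
      have "(1/2 - d) \<cdot> \<one>\<^sub>E \<preceq> r \<cdot> \<one>\<^sub>E"
        using r ge d one_closed by (intro scal_mono_left) auto
      moreover have "r \<cdot> \<one>\<^sub>E \<preceq> c" using r unfolding R_def by simp
      ultimately have le: "(1/2 - d) \<cdot> \<one>\<^sub>E \<preceq> c"
        using eff_le_trans d scal_closed one_closed by simp
      have cl: "(1/2 - d) \<cdot> \<one>\<^sub>E \<in> carrier E" "d \<cdot> \<one>\<^sub>E \<in> carrier E" using scal_closed one_closed d by auto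
      have mb: "(1/2) \<cdot> b \<perp> d \<cdot> \<one>\<^sub>E" "(1/2) \<cdot> b \<in> carrier E" "(1/2) \<cdot> a' \<in> carrier E" "(1/2) \<cdot> b \<perp> (1/2) \<cdot> a'"
        using scal_orth[of "1/2" d b "\<one>\<^sub>E"] scal_orth[of "1/2" "1/2" b a'] scal_closed d b a' one_closed by auto
      \<comment> \<open>Halving (1/2 - d) 1 \<le> c makes room for the error: 1/4 = (1/2 - d)/2 +
        d/2 on the left, c/2 + d/2 on the right. The summand a'/4 occurs on both sides and will be
        cancelled.\<close>
      have "(1/4) \<cdot> a \<boxplus> (1/4) \<cdot> a' = (1/4) \<cdot> \<one>\<^sub>E" using scal_esum[of "1/4" a a'] a a' by simp
      also have "\<dots> = (1/2) \<cdot> (1/2 - d) \<cdot> \<one>\<^sub>E \<boxplus> (1/2) \<cdot> d \<cdot> \<one>\<^sub>E"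
        using scal_add[of "1/2 - d" d "\<one>\<^sub>E"] scal_esum[of "1/2" "(1/2 - d) \<cdot> \<one>\<^sub>E" "d \<cdot> \<one>\<^sub>E"]
          scal_mult[of "1/2" "1/2" "\<one>\<^sub>E"] d cl one_closed by simp
      also have "\<dots> \<preceq> (1/2) \<cdot> c \<boxplus> (1/2) \<cdot> d \<cdot> \<one>\<^sub>E"
        using le cl c eff_le_refl by (intro mix_mono) auto
      finally have "(1/4) \<cdot> a \<boxplus> (1/4) \<cdot> a' \<preceq> (1/2) \<cdot> c \<boxplus> (1/2) \<cdot> d \<cdot> \<one>\<^sub>E" .
      moreover have "(1/2) \<cdot> c \<boxplus> (1/2) \<cdot> d \<cdot> \<one>\<^sub>E = (1/2) \<cdot> ((1/2) \<cdot> b \<boxplus> d \<cdot> \<one>\<^sub>E) \<boxplus> (1/4) \<cdot> a'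
          \<and> (1/2) \<cdot> ((1/2) \<cdot> b \<boxplus> d \<cdot> \<one>\<^sub>E) \<perp> (1/4) \<cdot> a'"
      proof -
        have "(1/2) \<cdot> c = (1/2) \<cdot> (1/2) \<cdot> b \<boxplus> (1/4) \<cdot> a'" "(1/2) \<cdot> (1/2) \<cdot> b \<perp> (1/4) \<cdot> a'"
          using scal_esum[of "1/2" "(1/2) \<cdot> b" "(1/2) \<cdot> a'"] scal_mult[of "1/2" "1/2" a'] mb a'
          unfolding c_def by simp_all
        moreover have "(1/2) \<cdot> c \<perp> (1/2) \<cdot> d \<cdot> \<one>\<^sub>E" using scal_orth c cl by simp
        ultimately show ?thesis
          using esum_swap_right[of "(1/2) \<cdot> (1/2) \<cdot> b" "(1/4) \<cdot> a'" "(1/2) \<cdot> d \<cdot> \<one>\<^sub>E"]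
            scal_esum[of "1/2" "(1/2) \<cdot> b" "d \<cdot> \<one>\<^sub>E"] mb cl a' scal_closed by simp
      qed
      ultimately have "(1/4) \<cdot> a \<boxplus> (1/4) \<cdot> a' \<preceq> (1/2) \<cdot> ((1/2) \<cdot> b \<boxplus> d \<cdot> \<one>\<^sub>E) \<boxplus> (1/4) \<cdot> a'"
        "(1/2) \<cdot> ((1/2) \<cdot> b \<boxplus> d \<cdot> \<one>\<^sub>E) \<perp> (1/4) \<cdot> a'" by auto
      then have "(1/4) \<cdot> a \<preceq> (1/2) \<cdot> ((1/2) \<cdot> b \<boxplus> d \<cdot> \<one>\<^sub>E)"
        using esum_le_cancel[of "(1/4) \<cdot> a" "(1/4) \<cdot> a'" "(1/2) \<cdot> ((1/2) \<cdot> b \<boxplus> d \<cdot> \<one>\<^sub>E)"]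
          scal_orth[of "1/4" "1/4" a a'] scal_closed esum_closed mb cl a a' by simp
      then have "(1/2) \<cdot> (1/2) \<cdot> a \<preceq> (1/2) \<cdot> ((1/2) \<cdot> b \<boxplus> d \<cdot> \<one>\<^sub>E)"
        using scal_mult[of "1/2" "1/2" a] a by simp
      then show ?thesis
        using half_le_cancel scal_closed esum_closed mb cl a unfolding d_def by simp
    qed
    then show False using archimedean a b nle by blast
  qed
  obtain M where M: "R.adjoin c \<subseteq> M" "maximal_module_preorder E scal M"
    using ex_maximal_module_preorder[OF R.module_preorder_adjoin[OF c]] by blast
  interpret M: maximal_module_preorder E scal M by (rule M)
  have "M.lower c \<le> R.lower c"
    using M.lower_le R.adjoin_lower[OF c] R.lower_bounds[OF c] M(1) by blast
  moreover have "M.lower c = (1/2) * M.lower b + (1/2) * M.lower a'"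
    unfolding c_def using M.lower_mix a' b by simp
  moreover have "M.lower a + M.lower a' = 1"
    using M.lower_esum[of a a'] M.lower_one a a' by simp
  ultimately have "M.lower b < M.lower a" using s by simp
  then show ?thesis using characters_maximal[OF M(2)] a b by (intro bexI) auto
qed

end

section \<open>Basically disconnected spaces\<close>

text \<open>The functions max 0 (f n) are truncated at 1 and weighted by 2^-n, so that their sum
  converges uniformly and is continuous; a sum of nonnegative terms vanishes only if every term
  does.\<close>

lemma zero_set_in_INT:
  fixes f :: "nat \<Rightarrow> 'x \<Rightarrow> real"
  assumes f: "\<And>n. continuous_map X euclideanreal (f n)"
  shows "zero_set_in X {x \<in> topspace X. \<forall>n. f n x \<le> 0}"
proof -
  define h where "h n x = (1/2)^n * min 1 (max 0 (f n x))" for n x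
  have h: "\<And>n x. 0 \<le> h n x" "\<And>n x. h n x \<le> (1/2)^n" "\<And>n x. h n x = 0 \<longleftrightarrow> f n x \<le> 0"
    unfolding h_def by (auto simp: mult_left_le)
  have sm: "summable (\<lambda>n. h n x)" for x
    by (rule summable_comparison_test'[of "\<lambda>n. (1/2)^n" 0]) (use h in \<open>auto simp: summable_geometric\<close>)
  define g where "g x = (\<Sum>n. h n x)" for x
  have unif: "uniform_limit (topspace X) (\<lambda>n x. \<Sum>i<n. h i x) g sequentially"
    unfolding g_def
    by (rule Weierstrass_m_test[of _ _ "\<lambda>n. (1/2)^n"]) (use h in \<open>auto simp: summable_geometric\<close>)
  have "continuous_map X (Met_TC.mtopology) g"
  proof (rule Met_TC.continuous_map_uniform_limit[where F = sequentially and f = "\<lambda>n x. \<Sum>i<n. h i x"])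
    show "\<forall>\<^sub>F n in sequentially. continuous_map X Met_TC.mtopology (\<lambda>x. \<Sum>i<n. h i x)"
      unfolding h_def by (auto intro!: continuous_intros continuous_map_sum f always_eventually)
    show "\<forall>\<^sub>F n in sequentially. \<forall>x\<in>topspace X. g x \<in> UNIV \<and> dist (\<Sum>i<n. h i x) (g x) < e"
      if "0 < e" for e
      using unif that unfolding uniform_limit_iff by simp
  qed simp
  then have "continuous_map X euclideanreal g" by simp
  moreover have "g x = 0 \<longleftrightarrow> (\<forall>n. f n x \<le> 0)" for x
    unfolding g_def using suminf_eq_zero_iff[OF sm h(1)] h(3) by simp
  then have "{x \<in> topspace X. \<forall>n. f n x \<le> 0} = {x \<in> topspace X. g x = 0}" by simp
  ultimately show ?thesis unfolding zero_set_in_def by blast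
qed

text \<open>The sets K r are clopen and increase with r, so {m < r}, a union of sets K s, and {m >
  r}, a union of complements of such sets, are both open. A continuous l below all a n is at most r
  on U r, hence on its closure K r, which gives l \<le> m.\<close>

lemma basically_disconnected_Inf:
  fixes a :: "nat \<Rightarrow> 'x \<Rightarrow> real"
  assumes bd: "basically_disconnected X"
    and a: "\<And>n. continuous_map X euclideanreal (a n)"
    and nonneg: "\<And>n x. x \<in> topspace X \<Longrightarrow> 0 \<le> a n x"
    and le1: "\<And>n x. x \<in> topspace X \<Longrightarrow> a n x \<le> 1"
  obtains m where "continuous_map X euclideanreal m"
    and "\<And>n x. x \<in> topspace X \<Longrightarrow> m x \<le> a n x"
    and "\<And>l x. \<lbrakk>continuous_map X euclideanreal l; \<And>n x. x \<in> topspace X \<Longrightarrow> l x \<le> a n x; x \<in> topspace X\<rbrakk>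
      \<Longrightarrow> l x \<le> m x"
proof
  define U where "U r = {x \<in> topspace X. \<exists>n. a n x < r}" for r
  define K where "K r = X closure_of (U r)" for r
  have K_open: "openin X (K r)" for r
  proof -
    \<comment> \<open>The complement of U r is a zero-set, so its interior is closed; the complement
      of that interior is the closure of U r.\<close>
    have "zero_set_in X {x \<in> topspace X. \<forall>n. r - a n x \<le> 0}"
      by (intro zero_set_in_INT continuous_intros a)
    then have "closedin X (X interior_of {x \<in> topspace X. \<forall>n. r - a n x \<le> 0})"
      using bd unfolding basically_disconnected_def by blast
    moreover have "{x \<in> topspace X. \<forall>n. r - a n x \<le> 0} = topspace X - U r"
      unfolding U_def by (auto simp flip: not_less)
    ultimately show ?thesis unfolding K_def closure_of_interior_of by auto
  qed
  have K_closed: "closedin X (K r)" for r unfolding K_def by simp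
  have KX: "K r \<subseteq> topspace X" for r unfolding K_def by (rule closure_of_subset_topspace)
  have UK: "U r \<subseteq> K r" for r unfolding K_def U_def by (intro closure_of_subset) auto
  have K_mono: "K r \<subseteq> K s" if "r \<le> s" for r s
    unfolding K_def U_def using that by (intro closure_of_mono) (auto intro: less_le_trans)
  \<comment> \<open>The values lie in [0, 1], so K 2 is everything and K r is empty for r \<le> 0;
    the set whose infimum is m x is thus nonempty and bounded below.\<close>
  have "a 0 x < 2" if "x \<in> topspace X" for x using le1[OF that, of 0] by simp
  then have "U 2 = topspace X" unfolding U_def by blast
  then have K2: "K 2 = topspace X" using UK[of 2] KX[of 2] by simp
  have K0: "0 < r" if "x \<in> K r" for x r
  proof (rule ccontr)
    assume "\<not> 0 < r"
    then have "\<not> a n y < r" if "y \<in> topspace X" for n y using nonneg[OF that, of n] by linarith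
    then have "U r = {}" unfolding U_def by blast
    then show False using that unfolding K_def by simp
  qed
  define m where "m x = Inf {r. x \<in> K r}" for x
  have bdd: "bdd_below {r. x \<in> K r}" for x by (rule bdd_belowI[of _ 0]) (use K0 less_imp_le in blast)
  have m_le: "m x \<le> r" if "x \<in> K r" for x r
    unfolding m_def using bdd that by (intro cInf_lower) auto
  have m_ge: "r \<le> m x" if "x \<notin> K r" "x \<in> topspace X" for x r
    unfolding m_def
  proof (rule cInf_greatest)
    show "{r. x \<in> K r} \<noteq> {}" using K2 that by blast
    show "r \<le> s" if "s \<in> {r. x \<in> K r}" for s
      using that \<open>x \<notin> K r\<close> K_mono[of s r] linear[of r s] by blast
  qed
  show "continuous_map X euclideanreal m"
    unfolding continuous_map_upper_lower_semicontinuous_lt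
  proof (intro conjI allI)
    fix r
    have "{x \<in> topspace X. r < m x} = (\<Union>s\<in>{r<..}. topspace X - K s)"
    proof (intro equalityI subsetI)
      fix x assume x: "x \<in> {x \<in> topspace X. r < m x}"
      then obtain s where "r < s" "s < m x" using dense by blast
      then show "x \<in> (\<Union>s\<in>{r<..}. topspace X - K s)" using x m_le[of x s] by force
    next
      fix x assume "x \<in> (\<Union>s\<in>{r<..}. topspace X - K s)"
      then show "x \<in> {x \<in> topspace X. r < m x}" using m_ge by fastforce
    qed
    moreover have "openin X (\<Union>s\<in>{r<..}. topspace X - K s)"
      using K_closed by (intro openin_clauses(3)) blast
    ultimately show "openin X {x \<in> topspace X. r < m x}" by simp
    have "{x \<in> topspace X. m x < r} = (\<Union>s\<in>{..<r}. K s)"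
    proof (intro equalityI subsetI)
      fix x assume x: "x \<in> {x \<in> topspace X. m x < r}"
      then obtain s where "m x < s" "s < r" using dense by blast
      then show "x \<in> (\<Union>s\<in>{..<r}. K s)" using x m_ge[of x s] by force
    next
      fix x assume "x \<in> (\<Union>s\<in>{..<r}. K s)"
      then show "x \<in> {x \<in> topspace X. m x < r}" using m_le KX by fastforce
    qed
    moreover have "openin X (\<Union>s\<in>{..<r}. K s)"
      using K_open by (intro openin_clauses(3)) blast
    ultimately show "openin X {x \<in> topspace X. m x < r}" by simp
  qed
  show "m x \<le> a n x" if "x \<in> topspace X" for n x
  proof (rule field_le_epsilon)
    fix e :: real assume "0 < e"
    then have "x \<in> U (a n x + e)" unfolding U_def using that by (auto intro: exI[of _ n])
    then show "m x \<le> a n x + e" using UK m_le by blast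
  qed
  show "l x \<le> m x"
    if l: "continuous_map X euclideanreal l" and le: "\<And>n x. x \<in> topspace X \<Longrightarrow> l x \<le> a n x"
      and x: "x \<in> topspace X" for l x
    unfolding m_def
  proof (rule cInf_greatest)
    show "{r. x \<in> K r} \<noteq> {}" using K2 x by blast
    fix r assume "r \<in> {r. x \<in> K r}"
    moreover have "K r \<subseteq> {x \<in> topspace X. l x \<in> {..r}}"
      unfolding K_def
    proof (rule closure_of_minimal)
      show "U r \<subseteq> {x \<in> topspace X. l x \<in> {..r}}"
        unfolding U_def using order.strict_implies_order[OF le_less_trans[OF le]] by auto
      show "closedin X {x \<in> topspace X. l x \<in> {..r}}"
        using closedin_continuous_map_preimage[OF l, of "{..r}"] by simp
    qed
    ultimately show "l x \<le> r" by auto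
  qed
qed

text \<open>At each point off Z some a n vanishes, so {m > 0} is an open subset of Z and lies in its
  interior. At an interior point, a Urysohn function that vanishes outside the interior is below
  every a n, which forces m \<ge> 1 there. So the interior is {m \<ge> 1}, a closed set. Lower
  bounds l are tested only with values in [0, 1], because those are the functions that elements of E
  represent.\<close>

lemma basically_disconnectedI:
  assumes X: "normal_space X" "Hausdorff_space X"
    and Inf: "\<And>a :: nat \<Rightarrow> 'x \<Rightarrow> real. \<lbrakk>\<And>n. continuous_map X euclideanreal (a n);
        \<And>n x. x \<in> topspace X \<Longrightarrow> 0 \<le> a n x \<and> a n x \<le> 1;
        \<And>n x. x \<in> topspace X \<Longrightarrow> a (Suc n) x \<le> a n x\<rbrakk> \<Longrightarrow>
      \<exists>m. continuous_map X euclideanreal m \<and> (\<forall>n. \<forall>x\<in>topspace X. m x \<le> a n x) \<and>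
        (\<forall>l. continuous_map X euclideanreal l \<longrightarrow> (\<forall>x\<in>topspace X. 0 \<le> l x \<and> l x \<le> 1) \<longrightarrow>
          (\<forall>n. \<forall>x\<in>topspace X. l x \<le> a n x) \<longrightarrow> (\<forall>x\<in>topspace X. l x \<le> m x))"
  shows "basically_disconnected X"
  unfolding basically_disconnected_def
proof (intro allI impI)
  fix Z assume "zero_set_in X Z"
  then obtain h where h: "continuous_map X euclideanreal h" and Z: "Z = {x \<in> topspace X. h x = 0}"
    unfolding zero_set_in_def by blast
  define a where "a n x = max 0 (1 - real n * \<bar>h x\<bar>)" for n x
  have a: "continuous_map X euclideanreal (a n)" for n
    unfolding a_def by (intro continuous_intros h continuous_map_real_mult_left)
  have "a (Suc n) x \<le> a n x" for n x unfolding a_def by (auto simp: algebra_simps)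
  moreover have "0 \<le> a n x \<and> a n x \<le> 1" for n x unfolding a_def by auto
  ultimately obtain m where m: "continuous_map X euclideanreal m"
    and mle: "\<And>n x. x \<in> topspace X \<Longrightarrow> m x \<le> a n x"
    and mg: "\<And>l x. \<lbrakk>continuous_map X euclideanreal l; \<forall>x\<in>topspace X. 0 \<le> l x \<and> l x \<le> 1;
       \<forall>n. \<forall>x\<in>topspace X. l x \<le> a n x; x \<in> topspace X\<rbrakk> \<Longrightarrow> l x \<le> m x"
    using Inf[of a] a by metis
  have "X interior_of Z = {x \<in> topspace X. m x \<in> {1..}}"
  proof (intro equalityI subsetI)
    fix x0 assume x0: "x0 \<in> X interior_of Z"
    then have x0X: "x0 \<in> topspace X" using interior_of_subset_topspace[of X Z] by blast
    have "closedin X {x0}" "closedin X (topspace X - X interior_of Z)" "disjnt {x0} (topspace X - X interior_of Z)"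
      using X x0X x0 by (auto simp: closedin_Hausdorff_singleton)
    then obtain l where l: "continuous_map X (top_of_set {0..1::real}) l"
      "l ` {x0} \<subseteq> {1}" "l ` (topspace X - X interior_of Z) \<subseteq> {0}"
      using X(1) unfolding normal_space_iff_Urysohn by (meson disjnt_sym)
    have lc: "continuous_map X euclideanreal l" "\<And>x. x \<in> topspace X \<Longrightarrow> l x \<in> {0..1}"
      using l(1) by (auto simp: continuous_map_in_subtopology)
    have "l x \<le> a n x" if x: "x \<in> topspace X" for n x
    proof (cases "x \<in> X interior_of Z")
      case True
      then have "h x = 0" using interior_of_subset Z by fastforce
      then show ?thesis using lc(2)[OF x] unfolding a_def by simp
    next
      case False
      then have "l x = 0" using l(3) x by auto
      then show ?thesis unfolding a_def by simp
    qed
    then have "l x0 \<le> m x0" using mg lc x0X by simp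
    then show "x0 \<in> {x \<in> topspace X. m x \<in> {1..}}" using l(2) x0X by simp
  next
    fix x assume x: "x \<in> {x \<in> topspace X. m x \<in> {1..}}"
    have "{x \<in> topspace X. m x \<in> {0<..}} \<subseteq> Z"
    proof
      fix y assume y: "y \<in> {x \<in> topspace X. m x \<in> {0<..}}"
      have "h y = 0"
      proof (rule ccontr)
        assume "h y \<noteq> 0"
        then obtain n where "1 < real n * \<bar>h y\<bar>"
          using reals_Archimedean3[of "\<bar>h y\<bar>"] by auto
        then have "a n y = 0" unfolding a_def by simp
        then show False using mle[of y n] y by simp
      qed
      then show "y \<in> Z" using y Z by simp
    qed
    moreover have "openin X {x \<in> topspace X. m x \<in> {0<..}}"
      by (rule openin_continuous_map_preimage[OF m]) simp
    ultimately have "{x \<in> topspace X. m x \<in> {0<..}} \<subseteq> X interior_of Z" by (rule interior_of_maximal)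
    then show "x \<in> X interior_of Z" using x by auto
  qed
  then show "closedin X (X interior_of Z)"
    using closedin_continuous_map_preimage[OF m, of "{1..}"] by simp
qed

section \<open>The unit interval of C(X) as a sequential effect space\<close>

lemma mem_carrier_cont_unit_interval:
  "f \<in> carrier (cont_unit_interval X) \<longleftrightarrow> f \<in> extensional (topspace X) \<and>
    continuous_map X euclideanreal f \<and> (\<forall>x\<in>topspace X. 0 \<le> f x \<and> f x \<le> 1)"
  unfolding cont_unit_interval_def by simp

lemma restrict_mem_carrier_cont_unit_interval:
  assumes "continuous_map X euclideanreal f" "\<And>x. x \<in> topspace X \<Longrightarrow> 0 \<le> f x \<and> f x \<le> 1"
  shows "restrict f (topspace X) \<in> carrier (cont_unit_interval X)"
  using assms continuous_map_eq[of X euclideanreal f "restrict f (topspace X)"]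
  by (simp add: mem_carrier_cont_unit_interval)

lemma cont_unit_interval_simps [simp]:
  "\<zero>\<^sub>E\<^bsub>cont_unit_interval X\<^esub> = (\<lambda>x\<in>topspace X. 0)"
  "\<one>\<^sub>E\<^bsub>cont_unit_interval X\<^esub> = (\<lambda>x\<in>topspace X. 1)"
  "f \<perp>\<^bsub>cont_unit_interval X\<^esub> g \<longleftrightarrow> (\<forall>x\<in>topspace X. f x + g x \<le> 1)"
  "f \<boxplus>\<^bsub>cont_unit_interval X\<^esub> g = (\<lambda>x\<in>topspace X. f x + g x)"
  "f \<odot>\<^bsub>cont_unit_interval X\<^esub> g = (\<lambda>x\<in>topspace X. f x * g x)"
  unfolding cont_unit_interval_def by simp_all

lemma commutes_cont_unit_interval: "commutes (cont_unit_interval X) f g"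
  unfolding commutes_def by (simp add: mult.commute)

lemma effect_algebra_cont_unit_interval: "effect_algebra (cont_unit_interval X)"
proof
  let ?E = "cont_unit_interval X"
  note mem = mem_carrier_cont_unit_interval
  show "\<zero>\<^sub>E\<^bsub>?E\<^esub> \<in> carrier ?E" "\<one>\<^sub>E\<^bsub>?E\<^esub> \<in> carrier ?E"
    by (simp_all add: restrict_mem_carrier_cont_unit_interval)
  show "f \<boxplus>\<^bsub>?E\<^esub> g \<in> carrier ?E" if "f \<in> carrier ?E" "g \<in> carrier ?E" "f \<perp>\<^bsub>?E\<^esub> g" for f g
    using that unfolding cont_unit_interval_simps mem
    by (intro restrict_mem_carrier_cont_unit_interval[unfolded mem] continuous_intros) auto
  show "g \<perp>\<^bsub>?E\<^esub> f \<and> f \<boxplus>\<^bsub>?E\<^esub> g = g \<boxplus>\<^bsub>?E\<^esub> f" if "f \<perp>\<^bsub>?E\<^esub> g" for f g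
    using that by (simp add: add.commute)
  show "f \<perp>\<^bsub>?E\<^esub> g \<and> (f \<boxplus>\<^bsub>?E\<^esub> g) \<perp>\<^bsub>?E\<^esub> h \<and> f \<boxplus>\<^bsub>?E\<^esub> (g \<boxplus>\<^bsub>?E\<^esub> h) = (f \<boxplus>\<^bsub>?E\<^esub> g) \<boxplus>\<^bsub>?E\<^esub> h"
    if "f \<in> carrier ?E" "g \<in> carrier ?E" "h \<in> carrier ?E" "g \<perp>\<^bsub>?E\<^esub> h" "f \<perp>\<^bsub>?E\<^esub> (g \<boxplus>\<^bsub>?E\<^esub> h)" for f g h
    using that unfolding cont_unit_interval_simps mem by (fastforce simp: add.assoc)
  show "f \<perp>\<^bsub>?E\<^esub> \<zero>\<^sub>E\<^bsub>?E\<^esub> \<and> f \<boxplus>\<^bsub>?E\<^esub> \<zero>\<^sub>E\<^bsub>?E\<^esub> = f" if "f \<in> carrier ?E" for f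
    using that unfolding cont_unit_interval_simps mem by (auto intro!: extensionalityI[of _ "topspace X"])
  show "f = \<zero>\<^sub>E\<^bsub>?E\<^esub>" if "f \<in> carrier ?E" "f \<perp>\<^bsub>?E\<^esub> \<one>\<^sub>E\<^bsub>?E\<^esub>" for f
    using that unfolding cont_unit_interval_simps mem
    by (intro extensionalityI[of _ "topspace X"]) (auto intro: order_antisym)
  show "\<exists>!g. g \<in> carrier ?E \<and> f \<perp>\<^bsub>?E\<^esub> g \<and> f \<boxplus>\<^bsub>?E\<^esub> g = \<one>\<^sub>E\<^bsub>?E\<^esub>" if f: "f \<in> carrier ?E" for f
  proof (rule ex1I[of _ "\<lambda>x\<in>topspace X. 1 - f x"])
    have "(\<lambda>x\<in>topspace X. 1 - f x) \<in> carrier ?E"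
      using f unfolding mem by (intro restrict_mem_carrier_cont_unit_interval[unfolded mem] continuous_intros) auto
    then show "(\<lambda>x\<in>topspace X. 1 - f x) \<in> carrier ?E \<and> f \<perp>\<^bsub>?E\<^esub> (\<lambda>x\<in>topspace X. 1 - f x) \<and>
        f \<boxplus>\<^bsub>?E\<^esub> (\<lambda>x\<in>topspace X. 1 - f x) = \<one>\<^sub>E\<^bsub>?E\<^esub>"
      by (auto intro!: extensionalityI[of _ "topspace X"])
    fix g assume g: "g \<in> carrier ?E \<and> f \<perp>\<^bsub>?E\<^esub> g \<and> f \<boxplus>\<^bsub>?E\<^esub> g = \<one>\<^sub>E\<^bsub>?E\<^esub>"
    have "f x + g x = 1" if "x \<in> topspace X" for x
      using g that unfolding cont_unit_interval_simps by (auto dest: fun_cong[of _ _ x])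
    then show "g = (\<lambda>x\<in>topspace X. 1 - f x)"
      using g unfolding mem by (intro extensionalityI[of _ "topspace X"]) (auto simp: algebra_simps)
  qed
qed

lemma eff_le_cont_unit_interval:
  assumes "f \<in> carrier (cont_unit_interval X)" "g \<in> carrier (cont_unit_interval X)"
  shows "f \<preceq>\<^bsub>cont_unit_interval X\<^esub> g \<longleftrightarrow> (\<forall>x\<in>topspace X. f x \<le> g x)"
proof
  assume "f \<preceq>\<^bsub>cont_unit_interval X\<^esub> g"
  then show "\<forall>x\<in>topspace X. f x \<le> g x"
    unfolding eff_le_def by (auto simp: mem_carrier_cont_unit_interval)
next
  assume le: "\<forall>x\<in>topspace X. f x \<le> g x"
  have "(\<lambda>x\<in>topspace X. g x - f x) \<in> carrier (cont_unit_interval X)"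
    using assms le unfolding mem_carrier_cont_unit_interval
    by (intro restrict_mem_carrier_cont_unit_interval[unfolded mem_carrier_cont_unit_interval]
        continuous_intros) (auto intro: add_increasing2 simp: algebra_simps)
  moreover have "f \<boxplus>\<^bsub>cont_unit_interval X\<^esub> (\<lambda>x\<in>topspace X. g x - f x) = g"
    using assms unfolding mem_carrier_cont_unit_interval
    by (intro extensionalityI[of _ "topspace X"]) auto
  moreover have "f \<perp>\<^bsub>cont_unit_interval X\<^esub> (\<lambda>x\<in>topspace X. g x - f x)"
    using assms unfolding mem_carrier_cont_unit_interval by auto
  ultimately show "f \<preceq>\<^bsub>cont_unit_interval X\<^esub> g" unfolding eff_le_def by blast
qed

lemma sequential_effect_algebra_cont_unit_interval:
  "sequential_effect_algebra (cont_unit_interval X)"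
proof -
  let ?E = "cont_unit_interval X"
  note mem = mem_carrier_cont_unit_interval
  interpret effect_algebra ?E by (rule effect_algebra_cont_unit_interval)
  show ?thesis
  proof
    show "f \<odot>\<^bsub>?E\<^esub> g \<in> carrier ?E" if "f \<in> carrier ?E" "g \<in> carrier ?E" for f g
      using that unfolding cont_unit_interval_simps mem
      by (intro restrict_mem_carrier_cont_unit_interval[unfolded mem] continuous_intros)
        (auto intro: mult_le_one)
    show "f \<odot>\<^bsub>?E\<^esub> g \<perp>\<^bsub>?E\<^esub> f \<odot>\<^bsub>?E\<^esub> h \<and> f \<odot>\<^bsub>?E\<^esub> (g \<boxplus>\<^bsub>?E\<^esub> h) = (f \<odot>\<^bsub>?E\<^esub> g) \<boxplus>\<^bsub>?E\<^esub> (f \<odot>\<^bsub>?E\<^esub> h)"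
      if "f \<in> carrier ?E" "g \<in> carrier ?E" "h \<in> carrier ?E" "g \<perp>\<^bsub>?E\<^esub> h" for f g h
    proof
      have "f x * g x + f x * h x \<le> 1" if x: "x \<in> topspace X" for x
      proof -
        have "f x * (g x + h x) \<le> 1 * 1"
          using that \<open>f \<in> carrier ?E\<close> \<open>g \<in> carrier ?E\<close> \<open>h \<in> carrier ?E\<close> \<open>g \<perp>\<^bsub>?E\<^esub> h\<close>
          unfolding cont_unit_interval_simps mem by (intro mult_mono) auto
        then show ?thesis by (simp add: distrib_left)
      qed
      then show "f \<odot>\<^bsub>?E\<^esub> g \<perp>\<^bsub>?E\<^esub> f \<odot>\<^bsub>?E\<^esub> h" by simp
      show "f \<odot>\<^bsub>?E\<^esub> (g \<boxplus>\<^bsub>?E\<^esub> h) = (f \<odot>\<^bsub>?E\<^esub> g) \<boxplus>\<^bsub>?E\<^esub> (f \<odot>\<^bsub>?E\<^esub> h)"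
        by (intro extensionalityI[of _ "topspace X"]) (auto simp: distrib_left)
    qed
    show "\<one>\<^sub>E\<^bsub>?E\<^esub> \<odot>\<^bsub>?E\<^esub> f = f" if "f \<in> carrier ?E" for f
      using that unfolding mem by (intro extensionalityI[of _ "topspace X"]) auto
    show "g \<odot>\<^bsub>?E\<^esub> f = \<zero>\<^sub>E\<^bsub>?E\<^esub>" if "f \<odot>\<^bsub>?E\<^esub> g = \<zero>\<^sub>E\<^bsub>?E\<^esub>" for f g
      using that by (simp add: mult.commute)
    show "f \<odot>\<^bsub>?E\<^esub> (g \<odot>\<^bsub>?E\<^esub> h) = (f \<odot>\<^bsub>?E\<^esub> g) \<odot>\<^bsub>?E\<^esub> h" for f g h
      by (intro extensionalityI[of _ "topspace X"]) auto
  qed (rule commutes_cont_unit_interval)+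
qed

lemma sigma_sea_cont_unit_interval:
  assumes bd: "basically_disconnected X"
  shows "sigma_sea (cont_unit_interval X)"
proof -
  let ?E = "cont_unit_interval X"
  note mem = mem_carrier_cont_unit_interval
  interpret sequential_effect_algebra ?E by (rule sequential_effect_algebra_cont_unit_interval)
  show ?thesis
  proof
    fix a :: "nat \<Rightarrow> 'a \<Rightarrow> real"
    assume a: "\<And>i. a i \<in> carrier ?E"
    obtain m where m: "continuous_map X euclideanreal m"
        and mle: "\<And>n x. x \<in> topspace X \<Longrightarrow> m x \<le> a n x"
        and mg: "\<And>l x. \<lbrakk>continuous_map X euclideanreal l; \<And>n x. x \<in> topspace X \<Longrightarrow> l x \<le> a n x;
          x \<in> topspace X\<rbrakk> \<Longrightarrow> l x \<le> m x"
      using basically_disconnected_Inf[OF bd, of a] a unfolding mem by auto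
    \<comment> \<open>The constant 0 is a continuous lower bound of all a n, hence below m.\<close>
    have "0 \<le> m x \<and> m x \<le> 1" if "x \<in> topspace X" for x
      using mg[of "\<lambda>_. 0" x] order_trans[OF mle[of x 0], of 1] a that unfolding mem by auto
    then have mc: "restrict m (topspace X) \<in> carrier ?E"
      using restrict_mem_carrier_cont_unit_interval m by blast
    have "is_eff_inf ?E (range a) (restrict m (topspace X))"
      unfolding is_eff_inf_def using mc a mle mg by (auto simp: eff_le_cont_unit_interval mem)
    then show "\<exists>m. is_eff_inf ?E (range a) m" by blast
  next
    fix a :: "nat \<Rightarrow> 'a \<Rightarrow> real" and b m
    assume a: "\<And>i. a i \<in> carrier ?E" and b: "b \<in> carrier ?E" and m: "is_eff_inf ?E (range a) m"
    have mc: "m \<in> carrier ?E" and mle: "\<And>n x. x \<in> topspace X \<Longrightarrow> m x \<le> a n x"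
      using m a unfolding is_eff_inf_def by (auto simp: eff_le_cont_unit_interval)
    have mg: "l x \<le> m x" if "l \<in> carrier ?E" "\<And>n x. x \<in> topspace X \<Longrightarrow> l x \<le> a n x" "x \<in> topspace X" for l x
      using m a that unfolding is_eff_inf_def by (auto simp: eff_le_cont_unit_interval)
    have bm: "b \<odot>\<^bsub>?E\<^esub> m \<in> carrier ?E" and ba: "b \<odot>\<^bsub>?E\<^esub> a n \<in> carrier ?E" for n
      using sprod_closed a b mc by auto
    have b01: "0 \<le> b x" "b x \<le> 1" if "x \<in> topspace X" for x using b that unfolding mem by auto
    have "l x \<le> b x * m x"
      if l: "l \<in> carrier ?E" and le: "\<And>n x. x \<in> topspace X \<Longrightarrow> l x \<le> b x * a n x" and x: "x \<in> topspace X"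
      for l x
    proof -
      \<comment> \<open>The infimum need not be pointwise, and b may vanish, so l cannot simply be
        divided by b. Instead the excess of l over b m is added to m: it is at most b (a n - m)
        \<le> a n - m, so k is still below every a n, whence k \<le> m and the excess is 0.\<close>
      define k where "k x = m x + max 0 (l x - b x * m x)" for x
      have kle: "k x \<le> a n x" if "x \<in> topspace X" for x n
      proof -
        have "l x - b x * m x \<le> b x * (a n x - m x)" using le[OF that] by (simp add: algebra_simps)
        also have "\<dots> \<le> 1 * (a n x - m x)" using b01 mle that by (intro mult_right_mono) auto
        finally show ?thesis unfolding k_def using mle[OF that, of n] by simp
      qed
      have "0 \<le> k x \<and> k x \<le> 1" if "x \<in> topspace X" for x
        using kle[OF that, of 0] a[of 0] mc that unfolding mem k_def by fastforce
      moreover have "continuous_map X euclideanreal k"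
        unfolding k_def using l b mc unfolding mem by (intro continuous_intros) auto
      ultimately have "restrict k (topspace X) \<in> carrier ?E"
        using restrict_mem_carrier_cont_unit_interval by blast
      then have "k x \<le> m x" using mg[of "restrict k (topspace X)" x] kle x by simp
      then show ?thesis unfolding k_def by simp
    qed
    then have "l \<preceq>\<^bsub>?E\<^esub> b \<odot>\<^bsub>?E\<^esub> m" if "l \<in> carrier ?E" "\<And>n. l \<preceq>\<^bsub>?E\<^esub> b \<odot>\<^bsub>?E\<^esub> a n" for l
      using that unfolding eff_le_cont_unit_interval[OF that(1) ba] eff_le_cont_unit_interval[OF that(1) bm]
      by simp
    moreover have "b \<odot>\<^bsub>?E\<^esub> m \<preceq>\<^bsub>?E\<^esub> b \<odot>\<^bsub>?E\<^esub> a n" for n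
      unfolding eff_le_cont_unit_interval[OF bm ba] using mle b01 by (simp add: mult_left_mono)
    ultimately show "is_eff_inf ?E (range (\<lambda>i. b \<odot>\<^bsub>?E\<^esub> a i)) (b \<odot>\<^bsub>?E\<^esub> m)"
      unfolding is_eff_inf_def using bm by blast
  qed (rule commutes_cont_unit_interval)
qed

theorem commutative_ses_cont_unit_interval:
  assumes "basically_disconnected X"
  shows "commutative_ses (cont_unit_interval X) (cont_scal X)"
proof -
  let ?E = "cont_unit_interval X"
  note mem = mem_carrier_cont_unit_interval
  interpret sigma_sea ?E by (rule sigma_sea_cont_unit_interval[OF assms])
  show ?thesis
  proof
    show "cont_scal X r f \<in> carrier ?E" if "r \<in> {0..1}" "f \<in> carrier ?E" for r f
      using that unfolding cont_scal_def mem
      by (intro restrict_mem_carrier_cont_unit_interval[unfolded mem] continuous_map_real_mult_left)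
        (auto intro: mult_le_one)
    show "cont_scal X r f \<perp>\<^bsub>?E\<^esub> cont_scal X s f \<and>
        cont_scal X r f \<boxplus>\<^bsub>?E\<^esub> cont_scal X s f = cont_scal X (r + s) f"
      if "r \<in> {0..1}" "s \<in> {0..1}" "r + s \<le> 1" "f \<in> carrier ?E" for r s f
    proof
      have "r * f x + s * f x \<le> 1" if "x \<in> topspace X" for x
        using mult_mono[of "r + s" 1 "f x" 1] that \<open>r + s \<le> 1\<close> \<open>f \<in> carrier ?E\<close> unfolding mem
        by (simp add: distrib_right)
      then show "cont_scal X r f \<perp>\<^bsub>?E\<^esub> cont_scal X s f" by (simp add: cont_scal_def)
      show "cont_scal X r f \<boxplus>\<^bsub>?E\<^esub> cont_scal X s f = cont_scal X (r + s) f"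
        unfolding cont_scal_def by (intro extensionalityI[of _ "topspace X"]) (auto simp: distrib_right)
    qed
    show "cont_scal X (r * s) f = cont_scal X r (cont_scal X s f)" for r s f
      unfolding cont_scal_def by (intro extensionalityI[of _ "topspace X"]) auto
    show "cont_scal X 0 f = \<zero>\<^sub>E\<^bsub>?E\<^esub>" for f
      unfolding cont_scal_def by simp
    show "cont_scal X 1 f = f" if "f \<in> carrier ?E" for f
      using that unfolding cont_scal_def mem by (intro extensionalityI[of _ "topspace X"]) auto
    show "cont_scal X r f \<perp>\<^bsub>?E\<^esub> cont_scal X r g \<and>
        cont_scal X r f \<boxplus>\<^bsub>?E\<^esub> cont_scal X r g = cont_scal X r (f \<boxplus>\<^bsub>?E\<^esub> g)"
      if "r \<in> {0..1}" "f \<in> carrier ?E" "g \<in> carrier ?E" "f \<perp>\<^bsub>?E\<^esub> g" for r f g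
    proof
      have "r * f x + r * g x \<le> 1" if "x \<in> topspace X" for x
        using mult_mono[of r 1 "f x + g x" 1] that \<open>r \<in> {0..1}\<close> \<open>f \<in> carrier ?E\<close> \<open>g \<in> carrier ?E\<close>
          \<open>f \<perp>\<^bsub>?E\<^esub> g\<close> unfolding mem cont_unit_interval_simps by (simp add: distrib_left)
      then show "cont_scal X r f \<perp>\<^bsub>?E\<^esub> cont_scal X r g" by (simp add: cont_scal_def)
      show "cont_scal X r f \<boxplus>\<^bsub>?E\<^esub> cont_scal X r g = cont_scal X r (f \<boxplus>\<^bsub>?E\<^esub> g)"
        unfolding cont_scal_def by (intro extensionalityI[of _ "topspace X"]) (auto simp: distrib_left)
    qed
  qed (rule commutes_cont_unit_interval)
qed

section \<open>The representation\<close>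

lemma continuous_on_eval: "continuous_on S (\<lambda>h::'a \<Rightarrow> 'b::topological_space. h x)"
  by (rule continuous_on_subset[OF continuous_on_product_coordinates]) simp

lemma Hausdorff_space_top_of_set: "Hausdorff_space (top_of_set (S :: 'a::t2_space set))"
proof (rule Hausdorff_space_subtopology)
  show "Hausdorff_space (euclidean :: 'a topology)"
    unfolding Hausdorff_space_def disjnt_def by (simp add: separation_t2)
qed

context commutative_ses
begin

lemma charactersD:
  assumes "\<phi> \<in> characters"
  shows characters_outside: "a \<notin> carrier E \<Longrightarrow> \<phi> a = 0"
    and characters_nonneg: "a \<in> carrier E \<Longrightarrow> 0 \<le> \<phi> a"
    and characters_one: "\<phi> \<one>\<^sub>E = 1"
    and characters_esum: "\<lbrakk>a \<perp> b; a \<in> carrier E; b \<in> carrier E\<rbrakk> \<Longrightarrow> \<phi> (a \<boxplus> b) = \<phi> a + \<phi> b"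
    and characters_sprod: "\<lbrakk>a \<in> carrier E; b \<in> carrier E\<rbrakk> \<Longrightarrow> \<phi> (a \<odot> b) = \<phi> a * \<phi> b"
    and characters_scal: "\<lbrakk>r \<in> {0..1}; a \<in> carrier E\<rbrakk> \<Longrightarrow> \<phi> (r \<cdot> a) = r * \<phi> a"
  using assms unfolding characters_def by blast+

lemma characters_zero: "\<phi> \<in> characters \<Longrightarrow> \<phi> \<zero>\<^sub>E = 0"
  using characters_scal[of \<phi> 0 "\<one>\<^sub>E"] scal_zero one_closed by simp

lemma characters_ecompl:
  assumes "\<phi> \<in> characters" "a \<in> carrier E"
  shows "\<phi> (ecompl E a) = 1 - \<phi> a"
  using characters_esum[OF assms(1), of a "ecompl E a"] characters_one[OF assms(1)] ecompl assms by simp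

lemma characters_mix:
  "\<lbrakk>\<phi> \<in> characters; r \<in> {0..1}; s \<in> {0..1}; r + s \<le> 1; a \<in> carrier E; b \<in> carrier E\<rbrakk>
    \<Longrightarrow> \<phi> (r \<cdot> a \<boxplus> s \<cdot> b) = r * \<phi> a + s * \<phi> b"
  using characters_esum[of \<phi> "r \<cdot> a" "s \<cdot> b"] characters_scal scal_orth scal_closed by simp

lemma characters_le_one: "\<lbrakk>\<phi> \<in> characters; a \<in> carrier E\<rbrakk> \<Longrightarrow> \<phi> a \<le> 1"
  using characters_ecompl[of \<phi> a] characters_nonneg[of \<phi> "ecompl E a"] ecompl_closed by simp

lemma eff_le_iff_characters:
  assumes "a \<in> carrier E" "b \<in> carrier E"
  shows "a \<preceq> b \<longleftrightarrow> (\<forall>\<phi>\<in>characters. \<phi> a \<le> \<phi> b)"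
proof
  assume "a \<preceq> b"
  then obtain z where "z \<in> carrier E" "a \<perp> z" "a \<boxplus> z = b" by (rule eff_leE)
  then show "\<forall>\<phi>\<in>characters. \<phi> a \<le> \<phi> b"
    using characters_esum[of _ a z] characters_nonneg[of _ z] assms by fastforce
next
  assume "\<forall>\<phi>\<in>characters. \<phi> a \<le> \<phi> b"
  then show "a \<preceq> b" using characters_separate[OF assms] by force
qed

lemma orth_iff_characters:
  assumes "a \<in> carrier E" "b \<in> carrier E"
  shows "a \<perp> b \<longleftrightarrow> (\<forall>\<phi>\<in>characters. \<phi> a + \<phi> b \<le> 1)"
proof -
  have "\<phi> a \<le> \<phi> (ecompl E b) \<longleftrightarrow> \<phi> a + \<phi> b \<le> 1" if "\<phi> \<in> characters" for \<phi>
    using characters_ecompl[OF that assms(2)] by auto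
  then show ?thesis
    using orth_iff_le_ecompl[OF assms] eff_le_iff_characters[OF assms(1) ecompl_closed[OF assms(2)]]
    by simp
qed

lemma eq_iff_characters:
  assumes "a \<in> carrier E" "b \<in> carrier E"
  shows "a = b \<longleftrightarrow> (\<forall>\<phi>\<in>characters. \<phi> a = \<phi> b)"
  using eff_le_antisym[of a b] eff_le_iff_characters[of a b] eff_le_iff_characters[of b a] assms by auto

text \<open>Tychonoff: the value 0 off the carrier and the bounds on it place every character in a
  power of [0, 1], and each defining condition is a closed condition on finitely many
  coordinates.\<close>

lemma compact_characters: "compact characters"
proof -
  have "compactin (product_topology (\<lambda>i::'a. euclideanreal) UNIV) (PiE UNIV (\<lambda>_. {0..1}))"
    by (simp add: compactin_PiE)
  then have "compact (PiE UNIV (\<lambda>_::'a. {0..1::real}))"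
    by (simp add: euclidean_product_topology)
  moreover have "closed characters"
    unfolding characters_def Ball_def
    by (intro closed_Collect_conj closed_Collect_all closed_Collect_imp open_Collect_const
        closed_Collect_eq closed_Collect_le continuous_intros continuous_on_product_coordinates)
  moreover have "characters \<subseteq> PiE UNIV (\<lambda>_. {0..1})"
  proof
    fix \<phi> assume "\<phi> \<in> characters"
    then have "\<phi> a \<in> {0..1}" for a
      using characters_outside[of \<phi> a] characters_nonneg[of \<phi> a] characters_le_one[of \<phi> a]
      by (cases "a \<in> carrier E") auto
    then show "\<phi> \<in> PiE UNIV (\<lambda>_. {0..1})" by auto
  qed
  ultimately show ?thesis using compact_Int_closed by (metis inf.absorb_iff2)
qed

text \<open>A multiplication by 2^k inside E. No character exceeds 1/2 on an element below 2^-(k+1)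
  1, so such an element is orthogonal to itself and can be doubled. Doubling lowers the exponent by
  one, and \<open>half_double\<close> undoes it.\<close>

lemma ex_dyadic_multiple:
  "\<lbrakk>w \<in> carrier E; w \<preceq> ((1/2)^k) \<cdot> \<one>\<^sub>E\<rbrakk> \<Longrightarrow> \<exists>b\<in>carrier E. w = ((1/2)^k) \<cdot> b"
proof (induction k arbitrary: w)
  case 0
  then show ?case using scal_one by auto
next
  case (Suc k)
  have p: "(1/2::real)^k \<in> {0..1}" by (simp add: power_le_one)
  have p': "(1/2::real)^Suc k \<in> {0..1}" using power_le_one[of "1/2::real" "Suc k"] by simp
  have le: "\<phi> w \<le> (1/2)^Suc k" if "\<phi> \<in> characters" for \<phi>
  proof -
    have "\<phi> w \<le> \<phi> (((1/2)^Suc k) \<cdot> \<one>\<^sub>E)"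
      using eff_le_iff_characters[of w] Suc.prems scal_closed[OF p' one_closed] that by blast
    then show ?thesis using characters_scal[OF that p' one_closed] characters_one[OF that] by simp
  qed
  have "2 * \<phi> w \<le> (1/2)^k" if "\<phi> \<in> characters" for \<phi> using le[OF that] by simp
  then have le2: "\<phi> w + \<phi> w \<le> (1/2)^k" if "\<phi> \<in> characters" for \<phi> using that by fastforce
  have o: "w \<perp> w"
    using orth_iff_characters[of w w] Suc.prems order_trans[OF le2] p by simp
  have c: "w \<boxplus> w \<in> carrier E" using esum_closed o Suc.prems by blast
  have "\<phi> (w \<boxplus> w) \<le> \<phi> (((1/2)^k) \<cdot> \<one>\<^sub>E)" if "\<phi> \<in> characters" for \<phi>
    using characters_esum[OF that o Suc.prems(1) Suc.prems(1)] le2[OF that]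
      characters_scal[OF that p one_closed] characters_one[OF that] by simp
  then have "w \<boxplus> w \<preceq> ((1/2)^k) \<cdot> \<one>\<^sub>E"
    using eff_le_iff_characters[OF c scal_closed[OF p one_closed]] by blast
  then obtain b where b: "b \<in> carrier E" "w \<boxplus> w = ((1/2)^k) \<cdot> b" using Suc.IH[OF c] by blast
  then have "w = (1/2) \<cdot> ((1/2)^k) \<cdot> b" using half_double[OF Suc.prems(1) o] by simp
  then have "w = ((1/2)^Suc k) \<cdot> b" using scal_mult[of "1/2" "(1/2)^k" b] p b by simp
  then show ?case using b by blast
qed

text \<open>The numbers r and s may exceed 1 and then do not act on E. Everything is first shrunk by
  t = 2^-k with t (r + s) \<le> 1; the difference w of (t r) a and (t s) 1 exists because characters
  determine the order, and \<open>ex_dyadic_multiple\<close> divides w by t.\<close>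

lemma ex_affine_image:
  assumes a: "a \<in> carrier E" and nonneg: "0 \<le> r" "0 \<le> s"
    and bounds: "\<And>\<phi>. \<phi> \<in> characters \<Longrightarrow> 0 \<le> r * \<phi> a - s \<and> r * \<phi> a - s \<le> 1"
  shows "\<exists>b\<in>carrier E. \<forall>\<phi>\<in>characters. \<phi> b = r * \<phi> a - s"
proof -
  obtain k where k: "r + s < 2^k" using real_arch_pow[of 2 "r + s"] by auto
  define t :: real where "t = (1/2)^k"
  have t: "0 < t" "t \<in> {0..1}" unfolding t_def by (simp_all add: power_le_one)
  have "t * (r + s) \<le> t * 2^k" using k t by simp
  also have "t * 2^k = 1" unfolding t_def by (simp flip: power_mult_distrib)
  finally have ts: "t * r + t * s \<le> 1" by (simp add: distrib_left)
  have tr: "t * r \<in> {0..1}" "t * s \<in> {0..1}" using ts t nonneg by (auto intro: order_trans[OF _ ts])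
  have c: "(t * r) \<cdot> a \<in> carrier E" "(t * s) \<cdot> \<one>\<^sub>E \<in> carrier E" "t \<cdot> \<one>\<^sub>E \<in> carrier E"
    using scal_closed tr t a one_closed by auto
  have ev: "\<phi> ((t * r) \<cdot> a) = t * r * \<phi> a" "\<phi> ((t * s) \<cdot> \<one>\<^sub>E) = t * s" "\<phi> (t \<cdot> \<one>\<^sub>E) = t"
    if "\<phi> \<in> characters" for \<phi>
    using characters_scal[OF that] characters_one[OF that] tr t a one_closed by simp_all
  have "(t * s) \<cdot> \<one>\<^sub>E \<preceq> (t * r) \<cdot> a"
    unfolding eff_le_iff_characters[OF c(2,1)]
  proof
    fix \<phi> assume \<phi>: "\<phi> \<in> characters"
    have "t * s \<le> t * (r * \<phi> a)" using bounds[OF \<phi>] t by (intro mult_left_mono) auto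
    then show "\<phi> ((t * s) \<cdot> \<one>\<^sub>E) \<le> \<phi> ((t * r) \<cdot> a)" using ev[OF \<phi>] by (simp add: mult.assoc)
  qed
  then obtain w where w: "w \<in> carrier E" "(t * s) \<cdot> \<one>\<^sub>E \<perp> w" "(t * s) \<cdot> \<one>\<^sub>E \<boxplus> w = (t * r) \<cdot> a"
    by (rule eff_leE)
  have evw: "\<phi> w = t * (r * \<phi> a - s)" if "\<phi> \<in> characters" for \<phi>
    using characters_esum[OF that w(2)] w c ev[OF that] by (simp add: algebra_simps)
  have "w \<preceq> t \<cdot> \<one>\<^sub>E"
    unfolding eff_le_iff_characters[OF w(1) c(3)]
  proof
    fix \<phi> assume \<phi>: "\<phi> \<in> characters"
    have "t * (r * \<phi> a - s) \<le> t * 1" using bounds[OF \<phi>] t by (intro mult_left_mono) auto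
    then show "\<phi> w \<le> \<phi> (t \<cdot> \<one>\<^sub>E)" using ev[OF \<phi>] evw[OF \<phi>] by simp
  qed
  then obtain b where b: "b \<in> carrier E" "w = t \<cdot> b"
    using ex_dyadic_multiple[OF w(1), of k] unfolding t_def by blast
  have "\<phi> b = r * \<phi> a - s" if "\<phi> \<in> characters" for \<phi>
    using characters_scal[OF that t(2) b(1)] evw[OF that] t unfolding b(2) by simp
  then show ?thesis using b by blast
qed

text \<open>The real span of E, as functions on the characters. Since 2 a - 1 takes values in
  [-1, 1], one element with one positive factor also covers functions with negative values, so no
  difference of two elements has to be carried along. Values outside \<open>characters\<close> are
  left free.\<close>

definition affine_transforms :: "(('a \<Rightarrow> real) \<Rightarrow> real) set"
  where "affine_transforms = {g. \<exists>a\<in>carrier E. \<exists>r>0. \<forall>\<phi>\<in>characters. g \<phi> = r * (2 * \<phi> a - 1)}"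

lemma function_ring_affine_transforms: "function_ring_on affine_transforms characters"
proof
  show "compact characters" by (rule compact_characters)
  show "continuous_on characters g" if g: "g \<in> affine_transforms" for g
  proof -
    obtain a r where "\<forall>\<phi>\<in>characters. g \<phi> = r * (2 * \<phi> a - 1)"
      using g unfolding affine_transforms_def by blast
    moreover have "continuous_on characters (\<lambda>\<phi>. r * (2 * \<phi> a - 1))"
      by (intro continuous_intros continuous_on_eval)
    ultimately show ?thesis using continuous_on_cong[OF refl, of characters g] by simp
  qed
  show "(\<lambda>\<phi>. g \<phi> + h \<phi>) \<in> affine_transforms" if gh: "g \<in> affine_transforms" "h \<in> affine_transforms" for g h
  proof -
    obtain a r where a: "a \<in> carrier E" "0 < r" "\<And>\<phi>. \<phi> \<in> characters \<Longrightarrow> g \<phi> = r * (2 * \<phi> a - 1)"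
      using gh unfolding affine_transforms_def by blast
    obtain b s where b: "b \<in> carrier E" "0 < s" "\<And>\<phi>. \<phi> \<in> characters \<Longrightarrow> h \<phi> = s * (2 * \<phi> b - 1)"
      using gh unfolding affine_transforms_def by blast
    \<comment> \<open>The sum of r (2 a - 1) and s (2 b - 1) is (r + s) (2 c - 1) for the convex
      combination c of a and b with weights proportional to r and s.\<close>
    define c where "c = (r / (r + s)) \<cdot> a \<boxplus> (s / (r + s)) \<cdot> b"
    have rs: "r / (r + s) \<in> {0..1}" "s / (r + s) \<in> {0..1}" "r / (r + s) + s / (r + s) = 1"
      using a b by (auto simp flip: add_divide_distrib)
    have "c \<in> carrier E" unfolding c_def using rs a b by (intro mix_closed) auto
    moreover have "g \<phi> + h \<phi> = (r + s) * (2 * \<phi> c - 1)" if "\<phi> \<in> characters" for \<phi>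
    proof -
      have "(r + s) * \<phi> c = r * \<phi> a + s * \<phi> b"
      proof -
        have "r + s \<noteq> 0" using a b by simp
        then have "(r + s) * (r / (r + s) * \<phi> a + s / (r + s) * \<phi> b) = r * \<phi> a + s * \<phi> b"
          by (simp add: distrib_left)
        then show ?thesis
          unfolding c_def using characters_mix[OF that rs(1,2) _ a(1) b(1)] rs(3) by simp
      qed
      then show ?thesis using a(3)[OF that] b(3)[OF that] by (simp add: algebra_simps)
    qed
    ultimately show ?thesis
      unfolding affine_transforms_def using a b by (auto intro!: bexI[of _ c] exI[of _ "r + s"])
  qed
  show "(\<lambda>\<phi>. g \<phi> * h \<phi>) \<in> affine_transforms" if gh: "g \<in> affine_transforms" "h \<in> affine_transforms" for g h
  proof -
    obtain a r where a: "a \<in> carrier E" "0 < r" "\<And>\<phi>. \<phi> \<in> characters \<Longrightarrow> g \<phi> = r * (2 * \<phi> a - 1)"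
      using gh unfolding affine_transforms_def by blast
    obtain b s where b: "b \<in> carrier E" "0 < s" "\<And>\<phi>. \<phi> \<in> characters \<Longrightarrow> h \<phi> = s * (2 * \<phi> b - 1)"
      using gh unfolding affine_transforms_def by blast
    define a' b' where "a' = ecompl E a" and "b' = ecompl E b"
    have c': "a' \<in> carrier E" "b' \<in> carrier E" unfolding a'_def b'_def using ecompl_closed a b by auto
    have cp: "a \<odot> b \<in> carrier E" "a' \<odot> b' \<in> carrier E" using sprod_closed a b c' by auto
    \<comment> \<open>The product is represented through (2 a - 1) (2 b - 1) = 2 (a b + a' b') - 1,
      where a' and b' are the complements. The two summands are orthogonal because a b \<le> a and
      a' b' \<le> a'.\<close>
    have o: "a \<odot> b \<perp> a' \<odot> b'"
      using orth_mono[OF sprod_le sprod_le orth_ecompl, of a b b'] a b c' cp unfolding a'_def by simp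
    define c where "c = a \<odot> b \<boxplus> a' \<odot> b'"
    have "c \<in> carrier E" unfolding c_def using esum_closed cp o by blast
    moreover have "g \<phi> * h \<phi> = (r * s) * (2 * \<phi> c - 1)" if "\<phi> \<in> characters" for \<phi>
    proof -
      have c: "\<phi> c = \<phi> a * \<phi> b + (1 - \<phi> a) * (1 - \<phi> b)"
        unfolding c_def using characters_esum[OF that o] characters_sprod[OF that] characters_ecompl[OF that]
          a b c' cp by (simp add: a'_def b'_def)
      show ?thesis unfolding a(3)[OF that] b(3)[OF that] c by (simp add: algebra_simps)
    qed
    ultimately show ?thesis
      unfolding affine_transforms_def using a b by (auto intro!: bexI[of _ c] exI[of _ "r * s"])
  qed
  show "(\<lambda>_. c) \<in> affine_transforms" for c
  proof -
    \<comment> \<open>The summand 1 keeps r positive for c = 0; s solves r (2 s - 1) = c.\<close>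
    define r where "r = \<bar>c\<bar> + 1"
    define s where "s = (c / r + 1) / 2"
    have r: "0 < r" "\<bar>c\<bar> \<le> r" unfolding r_def by auto
    then have "- 1 \<le> c / r" "c / r \<le> 1" by (simp_all add: field_simps abs_le_iff)
    then have s: "s \<in> {0..1}" unfolding s_def by simp
    have "c = r * (2 * \<phi> (s \<cdot> \<one>\<^sub>E) - 1)" if "\<phi> \<in> characters" for \<phi>
      using characters_scal[OF that s one_closed] characters_one[OF that] r
      unfolding s_def by (simp add: field_simps)
    then show ?thesis
      unfolding affine_transforms_def using r scal_closed[OF s one_closed] by blast
  qed
  show "\<exists>g\<in>affine_transforms. g \<phi> \<noteq> g \<psi>"
    if "\<phi> \<in> characters" "\<psi> \<in> characters" "\<phi> \<noteq> \<psi>" for \<phi> \<psi>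
  proof -
    obtain a where "\<phi> a \<noteq> \<psi> a" using \<open>\<phi> \<noteq> \<psi>\<close> by auto
    then have "a \<in> carrier E" using characters_outside that by metis
    then have "(\<lambda>\<phi>. 1 * (2 * \<phi> a - 1)) \<in> affine_transforms"
      unfolding affine_transforms_def by (auto intro!: exI[of _ 1])
    then show ?thesis using \<open>\<phi> a \<noteq> \<psi> a\<close> by (intro bexI) auto
  qed
qed

text \<open>Stone-Weierstrass yields a positive multiple of some 2 a - 1, not an element of E. The
  margin e at both ends of [0, 1] keeps this approximation inside [0, 1], and
  \<open>ex_affine_image\<close> then turns it into an element.\<close>

lemma characters_dense:
  assumes f: "continuous_on characters f" and e: "0 < e"
    and bounds: "\<And>\<phi>. \<phi> \<in> characters \<Longrightarrow> e \<le> f \<phi> \<and> f \<phi> \<le> 1 - e"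
  shows "\<exists>a\<in>carrier E. \<forall>\<phi>\<in>characters. \<bar>f \<phi> - \<phi> a\<bar> < e"
proof -
  obtain g where "g \<in> affine_transforms" and g: "\<And>\<phi>. \<phi> \<in> characters \<Longrightarrow> \<bar>f \<phi> - g \<phi>\<bar> < e"
    using function_ring_on.Stone_Weierstrass_basic[OF function_ring_affine_transforms f e] by blast
  then obtain a r where a: "a \<in> carrier E" "0 < r" "\<And>\<phi>. \<phi> \<in> characters \<Longrightarrow> g \<phi> = r * (2 * \<phi> a - 1)"
    unfolding affine_transforms_def by blast
  have ga: "g \<phi> = (2 * r) * \<phi> a - r" if "\<phi> \<in> characters" for \<phi>
    using a(3)[OF that] by (simp add: algebra_simps)
  have "0 \<le> (2 * r) * \<phi> a - r \<and> (2 * r) * \<phi> a - r \<le> 1" if "\<phi> \<in> characters" for \<phi>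
    using g[OF that] bounds[OF that] unfolding ga[OF that] by (auto simp: abs_less_iff)
  then obtain b where "b \<in> carrier E" "\<And>\<phi>. \<phi> \<in> characters \<Longrightarrow> \<phi> b = (2 * r) * \<phi> a - r"
    using ex_affine_image[of a "2 * r" r] a by auto
  then show ?thesis using g ga by (intro bexI[of _ b]) auto
qed

text \<open>The function \<open>f\<close> is first squeezed into \<open>[1/4, 3/4]\<close>, which leaves room for a decreasing
  sequence of elements approximating it from above; their infimum represents it.\<close>

lemma characters_surj:
  assumes f: "continuous_on characters f"
    and bounds: "\<And>\<phi>. \<phi> \<in> characters \<Longrightarrow> 0 \<le> f \<phi> \<and> f \<phi> \<le> 1"
  shows "\<exists>a\<in>carrier E. \<forall>\<phi>\<in>characters. \<phi> a = f \<phi>"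
proof -
  define g where "g \<phi> = 1/4 + f \<phi> / 2" for \<phi>
  have gb: "1/4 \<le> g \<phi>" "g \<phi> \<le> 3/4" if "\<phi> \<in> characters" for \<phi>
    using bounds[OF that] unfolding g_def by auto
  have gc: "continuous_on characters (\<lambda>\<phi>. g \<phi> + t)" for t
    unfolding g_def by (intro continuous_intros f) simp
  \<comment> \<open>An approximation of g + 3 e n within e n lies between g + 2 e n and g + 4 e n.
    As 4 e (n+1) = 2 e n, successive approximations decrease; and e n \<le> 1/16 keeps g + 3 e n
    below 1 - e n, since g \<le> 3/4.\<close>
  define e :: "nat \<Rightarrow> real" where "e n = (1/2)^n / 16" for n
  have e: "0 < e n" "e n \<le> 1/16" "e n = 2 * e (Suc n)" for n
    unfolding e_def using power_le_one[of "1/2::real" n] by simp_all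
  have "\<exists>a\<in>carrier E. \<forall>\<phi>\<in>characters. \<bar>g \<phi> + 3 * e n - \<phi> a\<bar> < e n" for n
    using gb e[of n] by (intro characters_dense gc) fastforce+
  then obtain a where a: "\<And>n. a n \<in> carrier E"
    and ap: "\<And>n \<phi>. \<phi> \<in> characters \<Longrightarrow> \<bar>g \<phi> + 3 * e n - \<phi> (a n)\<bar> < e n"
    by metis
  have a_le: "\<phi> (a n) \<le> g \<phi> + 4 * e n" and a_ge: "g \<phi> + 2 * e n \<le> \<phi> (a n)"
    if "\<phi> \<in> characters" for \<phi> n
    using ap[OF that, of n] by (auto simp: abs_less_iff)
  have "a (Suc n) \<preceq> a n" for n
    unfolding eff_le_iff_characters[OF a a]
    using a_le[of _ "Suc n"] a_ge[of _ n] e(3)[of n] by force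
  then obtain m where m: "is_eff_inf E (range a) m" using ex_inf[of a] a by blast
  have mc: "m \<in> carrier E" and mle: "\<And>n. m \<preceq> a n"
    and mg: "\<And>l. l \<in> carrier E \<Longrightarrow> (\<And>n. l \<preceq> a n) \<Longrightarrow> l \<preceq> m"
    using m unfolding is_eff_inf_def by auto
  have small: "\<exists>n. 4 * e n < d" if "0 < d" for d
  proof -
    obtain n where "(1/2::real)^n < d" using real_arch_pow_inv[of d "1/2"] \<open>0 < d\<close> by auto
    then show ?thesis unfolding e_def using that by (intro exI[of _ n]) simp
  qed
  have mg_eq: "\<phi> m = g \<phi>" if \<phi>: "\<phi> \<in> characters" for \<phi>
  proof (rule antisym)
    show "\<phi> m \<le> g \<phi>"
    proof (rule field_le_epsilon)
      fix d :: real assume "0 < d"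
      then obtain n where "4 * e n < d" using small by blast
      moreover have "\<phi> m \<le> \<phi> (a n)" using mle eff_le_iff_characters[OF mc a] \<phi> by blast
      ultimately show "\<phi> m \<le> g \<phi> + d" using a_le[OF \<phi>, of n] by simp
    qed
    show "g \<phi> \<le> \<phi> m"
    proof (rule field_le_epsilon)
      fix d :: real assume "0 < d"
      then obtain n where n: "4 * e n < d" using small by blast
      \<comment> \<open>An approximation of g - e n within e n stays below g, hence below every a k,
        so m lies above it. The lower margin 1/4 of g leaves room for it.\<close>
      have "\<exists>l\<in>carrier E. \<forall>\<phi>\<in>characters. \<bar>g \<phi> + - e n - \<phi> l\<bar> < e n"
        using gb e[of n] by (intro characters_dense gc) fastforce+
      then obtain l where l: "l \<in> carrier E" and lp: "\<And>\<phi>. \<phi> \<in> characters \<Longrightarrow> \<bar>g \<phi> + - e n - \<phi> l\<bar> < e n"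
        by blast
      have "\<psi> l \<le> \<psi> (a k)" if "\<psi> \<in> characters" for \<psi> k
        using lp[OF that] a_ge[OF that, of k] e(1)[of k] unfolding abs_less_iff by linarith
      then have "l \<preceq> m" using mg l eff_le_iff_characters[OF l a] by blast
      then have "\<phi> l \<le> \<phi> m" using eff_le_iff_characters[OF l mc] \<phi> by blast
      then show "g \<phi> \<le> \<phi> m + d" using lp[OF \<phi>] n e(1)[of n] unfolding abs_less_iff by linarith
    qed
  qed
  \<comment> \<open>Undoes the squeezing of f.\<close>
  have "2 * \<phi> m - 1/2 = f \<phi>" if "\<phi> \<in> characters" for \<phi>
    using mg_eq[OF that] unfolding g_def by simp
  then show ?thesis using ex_affine_image[OF mc, of 2 "1/2"] bounds by auto
qed

text \<open>By \<open>characters_surj\<close> every continuous function with values in [0, 1] is the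
  evaluation at an element of E, and evaluation preserves and reflects the order. Infima of
  decreasing sequences therefore pass from E to C(X).\<close>

lemma basically_disconnected_characters: "basically_disconnected (top_of_set characters)"
proof (rule basically_disconnectedI)
  have "compact_space (top_of_set characters)" "Hausdorff_space (top_of_set characters)"
    using compact_characters by (simp_all add: compact_space_subtopology Hausdorff_space_top_of_set)
  then show "normal_space (top_of_set characters)" "Hausdorff_space (top_of_set characters)"
    using compact_Hausdorff_or_regular_imp_normal_space by auto
next
  fix a :: "nat \<Rightarrow> ('a \<Rightarrow> real) \<Rightarrow> real"
  assume c: "\<And>n. continuous_map (top_of_set characters) euclideanreal (a n)"
    and b: "\<And>n \<phi>. \<phi> \<in> topspace (top_of_set characters) \<Longrightarrow> 0 \<le> a n \<phi> \<and> a n \<phi> \<le> 1"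
    and d: "\<And>n \<phi>. \<phi> \<in> topspace (top_of_set characters) \<Longrightarrow> a (Suc n) \<phi> \<le> a n \<phi>"
  have "\<exists>x\<in>carrier E. \<forall>\<phi>\<in>characters. \<phi> x = a n \<phi>" for n
    using characters_surj[of "a n"] c b by simp
  then obtain x where x: "\<And>n. x n \<in> carrier E" and xa: "\<And>n \<phi>. \<phi> \<in> characters \<Longrightarrow> \<phi> (x n) = a n \<phi>"
    by metis
  have "x (Suc n) \<preceq> x n" for n
    using eff_le_iff_characters[OF x x] xa d by simp
  then obtain m where m: "is_eff_inf E (range x) m" using ex_inf[of x] x by blast
  have mc: "m \<in> carrier E" and mle: "\<And>n. m \<preceq> x n"
    and mg: "\<And>l. l \<in> carrier E \<Longrightarrow> (\<And>n. l \<preceq> x n) \<Longrightarrow> l \<preceq> m"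
    using m unfolding is_eff_inf_def by auto
  show "\<exists>m. continuous_map (top_of_set characters) euclideanreal m \<and>
      (\<forall>n. \<forall>\<phi>\<in>topspace (top_of_set characters). m \<phi> \<le> a n \<phi>) \<and>
      (\<forall>l. continuous_map (top_of_set characters) euclideanreal l \<longrightarrow>
        (\<forall>\<phi>\<in>topspace (top_of_set characters). 0 \<le> l \<phi> \<and> l \<phi> \<le> 1) \<longrightarrow>
        (\<forall>n. \<forall>\<phi>\<in>topspace (top_of_set characters). l \<phi> \<le> a n \<phi>) \<longrightarrow>
        (\<forall>\<phi>\<in>topspace (top_of_set characters). l \<phi> \<le> m \<phi>))"
  proof (intro exI[of _ "\<lambda>\<phi>. \<phi> m"] conjI allI impI)
    show "continuous_map (top_of_set characters) euclideanreal (\<lambda>\<phi>. \<phi> m)"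
      by (simp add: continuous_on_eval)
    show "\<forall>\<phi>\<in>topspace (top_of_set characters). \<phi> m \<le> a n \<phi>" for n
      using mle[of n] eff_le_iff_characters[OF mc x] xa by simp
    fix l assume l: "continuous_map (top_of_set characters) euclideanreal l"
      "\<forall>\<phi>\<in>topspace (top_of_set characters). 0 \<le> l \<phi> \<and> l \<phi> \<le> 1"
      "\<forall>n. \<forall>\<phi>\<in>topspace (top_of_set characters). l \<phi> \<le> a n \<phi>"
    then obtain y where y: "y \<in> carrier E" "\<And>\<phi>. \<phi> \<in> characters \<Longrightarrow> \<phi> y = l \<phi>"
      using characters_surj[of l] by auto
    have "y \<preceq> x n" for n using eff_le_iff_characters[OF y(1) x] xa y(2) l(3) by simp
    then have "y \<preceq> m" using mg y by blast
    then show "\<forall>\<phi>\<in>topspace (top_of_set characters). l \<phi> \<le> \<phi> m"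
      using eff_le_iff_characters[OF y(1) mc] y(2) by simp
  qed
qed

text \<open>Injectivity and the equivalence for orthogonality both rest on the characters
  determining the order; surjectivity is \<open>characters_surj\<close>.\<close>

lemma sea_iso_characters:
  "sea_iso E (cont_unit_interval (top_of_set characters)) (\<lambda>a. \<lambda>\<phi>\<in>characters. \<phi> a)"
  (is "sea_iso E ?C ?ev")
proof -
  have inj: "inj_on ?ev (carrier E)"
  proof (rule inj_onI)
    fix a b assume "a \<in> carrier E" "b \<in> carrier E" and eq: "?ev a = ?ev b"
    moreover have "\<phi> a = \<phi> b" if "\<phi> \<in> characters" for \<phi> using fun_cong[OF eq, of \<phi>] that by simp
    ultimately show "a = b" using eq_iff_characters by blast
  qed
  have "?ev a \<in> carrier ?C" if "a \<in> carrier E" for a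
    using restrict_mem_carrier_cont_unit_interval[of "top_of_set characters" "\<lambda>\<phi>. \<phi> a"] that
      characters_nonneg characters_le_one by (simp add: continuous_on_eval)
  moreover have "f \<in> ?ev ` carrier E" if f: "f \<in> carrier ?C" for f
  proof -
    obtain a where a: "a \<in> carrier E" "\<And>\<phi>. \<phi> \<in> characters \<Longrightarrow> \<phi> a = f \<phi>"
      using characters_surj[of f] f unfolding mem_carrier_cont_unit_interval by auto
    then have "f = ?ev a"
      using f unfolding mem_carrier_cont_unit_interval
      by (intro extensionalityI[of _ characters]) auto
    then show ?thesis using a by blast
  qed
  ultimately have "bij_betw ?ev (carrier E) (carrier ?C)"
    unfolding bij_betw_def using inj by blast
  then show ?thesis
    unfolding sea_iso_def
    using characters_zero characters_one characters_esum characters_sprod orth_iff_characters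
    by (auto cong: restrict_cong)
qed

end

theorem theorem4p10:
  "(\<forall>(E :: 'a seq_eff_alg) scal. commutative_ses E scal \<longrightarrow>
      (\<exists>X :: ('a \<Rightarrow> real) topology.
        compact_space X \<and> Hausdorff_space X \<and> basically_disconnected X \<and>
        sea_isomorphic E (cont_unit_interval X))) \<and>
   (\<forall>X :: 'x topology.
      compact_space X \<and> Hausdorff_space X \<and> basically_disconnected X \<longrightarrow>
        commutative_ses (cont_unit_interval X) (cont_scal X))"
proof (intro conjI allI impI)
  fix E :: "'a seq_eff_alg" and scal
  assume "commutative_ses E scal"
  then interpret commutative_ses E scal .
  have "compact_space (top_of_set characters)" "Hausdorff_space (top_of_set characters)"
    using compact_characters by (simp_all add: compact_space_subtopology Hausdorff_space_top_of_set)
  then show "\<exists>X :: ('a \<Rightarrow> real) topology.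
        compact_space X \<and> Hausdorff_space X \<and> basically_disconnected X \<and>
        sea_isomorphic E (cont_unit_interval X)"
    using basically_disconnected_characters sea_iso_characters unfolding sea_isomorphic_def by blast
qed (blast intro: commutative_ses_cont_unit_interval)

end
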